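(* ("Global normal form".) Consider an iterated function system with real smooth roof function $\tau$ and potential $V$ (see context). There is a neighborhood $\mathcal J\subset\mathbb R$ of $0$ such that for any bi-infinite admissible word $w=(\ldots,w_{-1},w_0,w_1,\ldots)\in\mathcal W$ there exist functions $\varUpsilon_w^{(0)},\varUpsilon_w^{(1)}\in C^\infty(I_{w_0};\mathbb R)$, with $\varUpsilon_w=\varUpsilon_w^{(0)}+\frac i\nu\varUpsilon_w^{(1)}\in C^\infty(I_{w_0};\mathbb C)$ for $\nu>0$, and a map $H_w:\mathcal J\to\mathbb R$ which is a $C^\infty$ diffeomorphism onto its image, such that the following holds. 1. There exists a neighborhood $U$ of $x_w$ such that the component $\mathcal L_{w_0,w_1}$ of the transfer operator, acting on $C_0^\infty(U)$, can be expressed as $$\mathcal L_{w_0,w_1}=e^{i\nu\tau(x_{L(w)})+V(x_{L(w)})}\cdot\widehat{\mathcal T}_{L(w)}\circ\hat D_{J_{w_0,w_1}(x_w)}\circ\widehat{\mathcal T}_w^{-1},\qquad \widehat{\mathcal T}_w:=\hat\Theta_{\varUpsilon_w}\circ\hat T_{x_w}\circ\hat{\mathcal L}_{H_w},$$ where the canonical map $\mathcal T_w$ of $\widehat{\mathcal T}_w$ sends $(0,0)$ to the point $(x_w,\xi_w)$. 2. $H_w(0)=0$, $H_w'(0)=1$, $\varUpsilon_w(x_w)=0$ and $\frac{d\varUpsilon_w^{(0)}}{dy}(y)=\zeta_w(y)$. 3. For any $\alpha\in\mathbb N$ there exists $C_\alpha$ such that for any $w\in\mathcal W$, $$|\partial^\alpha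 H_w|_{L^\infty}<C_\alpha,\qquad|\partial^\alpha H_w^{-1}|_{L^\infty}<C_\alpha,\qquad|\partial^\alpha\varUpsilon_w|_{L^\infty}<C_\alpha .$$
   Context: **IFS.** $I_1,\dots,I_N\subset\mathbb R$ ($N\ge1$) are disjoint bounded closed intervals; $A\in\{0,1\}^{N\times N}$ is primitive (some power $A^T$ has all entries positive); $i\rightsquigarrow j$ means $A_{i,j}=1$. For $i\rightsquigarrow j$, $\phi_{i,j}:I_i\to\phi_{i,j}(I_i)\subset\mathrm{Int}(I_j)$ is a smooth invertible map with $0<\phi_{i,j}'\le\theta$, $0<\theta<1$ fixed, and $(i,j)\ne(k,l)\Rightarrow\phi_{i,j}(I_i)\cap\phi_{k,l}(I_k)=\emptyset$. $I=\bigcup_iI_i$, $\phi(I)=\bigcup_{i\rightsquigarrow j}\phi_{i,j}(I_i)$, $\tau,V\in C^\infty(\phi(I);\mathbb R)$. $J_{i,j}(x):=-\log\phi_{i,j}'(x)>0$ for $x\in I_i$. **Transfer operator components.** Let $\nu>0$; $C_0^\infty(B)$ denotes smooth functions on $\mathbb R$ supported in $B$. For $i\rightsquigarrow j$, $\mathcal L_{i,j}:C_0^\infty(I_i)\to C_0^\infty(I_j)$ is $(\mathcal L_{i,j}\varphi)(x)=e^{i\nu\tau(x)+V(x)}\varphi(\phi_{i,j}^{-1}(x))$ for $x\in\phi_{i,j}(I_i)$ and $0$ otherwise. **Words.** $\mathcal W=\{w\in\{1,\dots,N\}^{\mathbb Z}:w_l\rightsquigarrow w_{l+1}\ \forall l\}$;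 left shift $(Lw)_j=w_{j+1}$. For $i<j$, $\phi_{w_{i,j}}=\phi_{w_{j-1},w_j}\circ\cdots\circ\phi_{w_i,w_{i+1}}:I_{w_i}\to I_{w_j}$. $x_w$ is the unique point of $\bigcap_{n\ge1}\phi_{w_{-n,0}}(I_{w_{-n}})\subset I_{w_0}$. For $x\in I_{w_0}$, $\zeta_w(x):=-\sum_{k\ge1}\phi_{w_{0,k}}'(x)\,\tau'(\phi_{w_{0,k}}(x))$, and $\xi_w:=\zeta_w(x_w)$. **Elementary operators and their canonical maps on $T^*\mathbb R\cong\mathbb R^2_{x,\xi}$.** Dilation: $(\hat D_\lambda\varphi)(y)=\varphi(e^\lambda y)$, $\lambda\in\mathbb R$, with $D_\lambda:(x,\xi)\mapsto(e^{-\lambda}x,e^\lambda\xi)$. Translation: $(\hat T_x\varphi)(y)=\varphi(y-x)$, with $T_x:(y,\xi)\mapsto(y+x,\xi)$. Composition, for a smooth diffeomorphism $f$ (onto its image): $(\hat{\mathcal L}_f\varphi)(y)=\varphi(f^{-1}(y))$, with $(x,\xi)\mapsto(f(x),f'(x)^{-1}\xi)$. Multiplication, for $\varUpsilon=\varUpsilon^{(0)}+\frac i\nu\varUpsilon^{(1)}$ with $\varUpsilon^{(0)},\varUpsilon^{(1)}$ real smooth: $(\hat\Theta_\varUpsilon\varphi)(y)=e^{i\nu\varUpsilon(y)}\varphi(y)$, with $(x,\xi)\mapsto(x,\xi+\frac{d\varUpsilon^{(0)}}{dx}(x))$. The canonical map of a composition is the composition of the canonical maps. The $L^\infty$ norms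 in item 3 are taken over the domains of definition of the functions; $C_\alpha$ is uniform in $w$ ($\nu$ being given). *)

theory Defs
  imports "HOL-Analysis.Analysis" "HOL-Probability.Essential_Supremum"
begin

section \<open>Smooth functions of one real variable\<close>

text \<open>Derivatives are taken within the domain \<open>S\<close>, i.e. they are one-sided at the endpoints of a
  closed interval. Only values on \<open>S\<close> matter as long as \<open>S\<close> has no isolated points; below, \<open>S\<close> is
  open or a finite disjoint union of nondegenerate compact intervals.\<close>

definition deriv_within :: "real set \<Rightarrow> (real \<Rightarrow> 'a::real_normed_vector) \<Rightarrow> real \<Rightarrow> 'a" where
  "deriv_within S f = (\<lambda>x. vector_derivative f (at x within S))"

definition nderiv :: "real set \<Rightarrow> nat \<Rightarrow> (real \<Rightarrow> 'a::real_normed_vector) \<Rightarrow> real \<Rightarrow> 'a" where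
  "nderiv S n f = (deriv_within S ^^ n) f"

definition smooth_on :: "real set \<Rightarrow> (real \<Rightarrow> 'a::real_normed_vector) \<Rightarrow> bool" where
  "smooth_on S f \<longleftrightarrow> (\<forall>n. nderiv S n f differentiable_on S)"

definition C0inf :: "real set \<Rightarrow> (real \<Rightarrow> complex) set" where
  "C0inf B = {f. smooth_on UNIV f \<and> closure (support_on UNIV f) \<subseteq> B}"

definition diffeo_onto_image :: "real set \<Rightarrow> (real \<Rightarrow> real) \<Rightarrow> bool" where
  "diffeo_onto_image S f \<longleftrightarrow>
     smooth_on S f \<and> inj_on f S \<and> smooth_on (f ` S) (inv_into S f)"

definition Linf_norm :: "real set \<Rightarrow> (real \<Rightarrow> 'a::real_normed_vector) \<Rightarrow> ereal" where
  "Linf_norm S f = esssup (restrict_space lborel S) (\<lambda>x. ereal (norm (f x)))"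


section \<open>Iterated function systems\<close>

definition adm :: "real^'n^'n \<Rightarrow> 'n \<Rightarrow> 'n::finite \<Rightarrow> bool" where
  "adm A i j \<longleftrightarrow> A $ i $ j = 1"

definition primitive_matrix :: "real^'n^'n \<Rightarrow> bool" where
  "primitive_matrix A \<longleftrightarrow> (\<exists>T\<ge>1. \<forall>i j. (((**) A ^^ T) (mat 1)) $ i $ j > 0)"

definition ifs_image ::
    "real^'n^'n \<Rightarrow> ('n \<Rightarrow> real set) \<Rightarrow> ('n \<Rightarrow> 'n \<Rightarrow> real \<Rightarrow> real) \<Rightarrow> real set" where
  "ifs_image A I \<phi> = (\<Union>(i, j)\<in>{(i, j). adm A i j}. \<phi> i j ` I i)"

text \<open>The finite index type \<open>'n\<close> plays the role of \<open>{1, \<dots>, N}\<close> with \<open>N = CARD('n) \<ge> 1\<close>.\<close>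

locale ifs =
  fixes A :: "real^'n^'n"
    and I :: "'n::finite \<Rightarrow> real set"
    and \<phi> :: "'n \<Rightarrow> 'n \<Rightarrow> real \<Rightarrow> real"
    and \<theta> :: real
  assumes interval: "\<exists>a b. a < b \<and> I i = {a..b}"
    and disjoint_intervals: "i \<noteq> j \<Longrightarrow> I i \<inter> I j = {}"
    and zero_one: "A $ i $ j \<in> {0, 1}"
    and primitive: "primitive_matrix A"
    and theta: "0 < \<theta>" "\<theta> < 1"
    and phi_smooth: "adm A i j \<Longrightarrow> smooth_on (I i) (\<phi> i j)"
    and phi_inj: "adm A i j \<Longrightarrow> inj_on (\<phi> i j) (I i)"
    and phi_into: "adm A i j \<Longrightarrow> \<phi> i j ` I i \<subseteq> interior (I j)"
    and phi_deriv: "adm A i j \<Longrightarrow> x \<in> I i \<Longrightarrow>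
          0 < deriv_within (I i) (\<phi> i j) x \<and> deriv_within (I i) (\<phi> i j) x \<le> \<theta>"
    and disjoint_images: "adm A i j \<Longrightarrow> adm A k l \<Longrightarrow> (i, j) \<noteq> (k, l) \<Longrightarrow>
          \<phi> i j ` I i \<inter> \<phi> k l ` I k = {}"

definition jac ::
    "('n \<Rightarrow> real set) \<Rightarrow> ('n \<Rightarrow> 'n \<Rightarrow> real \<Rightarrow> real) \<Rightarrow> 'n \<Rightarrow> 'n \<Rightarrow> real \<Rightarrow> real" where
  "jac I \<phi> i j x = - ln (deriv_within (I i) (\<phi> i j) x)"

definition transfer_op ::
    "('n \<Rightarrow> real set) \<Rightarrow> ('n \<Rightarrow> 'n \<Rightarrow> real \<Rightarrow> real) \<Rightarrow> (real \<Rightarrow> real) \<Rightarrow> (real \<Rightarrow> real) \<Rightarrow> real \<Rightarrow>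
     'n \<Rightarrow> 'n \<Rightarrow> (real \<Rightarrow> complex) \<Rightarrow> real \<Rightarrow> complex" where
  "transfer_op I \<phi> \<tau> V \<nu> i j f x =
     (if x \<in> \<phi> i j ` I i
      then exp (\<i> * of_real (\<nu> * \<tau> x) + of_real (V x)) * f (inv_into (I i) (\<phi> i j) x)
      else 0)"


section \<open>Bi-infinite words\<close>

definition words :: "real^'n^'n \<Rightarrow> (int \<Rightarrow> 'n::finite) set" where
  "words A = {w. \<forall>l. adm A (w l) (w (l + 1))}"

definition shift :: "(int \<Rightarrow> 'n) \<Rightarrow> int \<Rightarrow> 'n" where
  "shift w = (\<lambda>j. w (j + 1))"

primrec phi_iter ::
    "('n \<Rightarrow> 'n \<Rightarrow> real \<Rightarrow> real) \<Rightarrow> (int \<Rightarrow> 'n) \<Rightarrow> int \<Rightarrow> nat \<Rightarrow> real \<Rightarrow> real" where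
  "phi_iter \<phi> w i 0 = id"
| "phi_iter \<phi> w i (Suc n) = \<phi> (w (i + int n)) (w (i + int n + 1)) \<circ> phi_iter \<phi> w i n"

definition phi_word ::
    "('n \<Rightarrow> 'n \<Rightarrow> real \<Rightarrow> real) \<Rightarrow> (int \<Rightarrow> 'n) \<Rightarrow> int \<Rightarrow> int \<Rightarrow> real \<Rightarrow> real" where
  "phi_word \<phi> w i j = phi_iter \<phi> w i (nat (j - i))"

definition x_pt ::
    "('n \<Rightarrow> real set) \<Rightarrow> ('n \<Rightarrow> 'n \<Rightarrow> real \<Rightarrow> real) \<Rightarrow> (int \<Rightarrow> 'n) \<Rightarrow> real" where
  "x_pt I \<phi> w = (THE x. x \<in> (\<Inter>n\<in>{1::int..}. phi_word \<phi> w (- n) 0 ` I (w (- n))))"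

definition zeta_fn ::
    "real^'n^'n \<Rightarrow> ('n \<Rightarrow> real set) \<Rightarrow> ('n \<Rightarrow> 'n \<Rightarrow> real \<Rightarrow> real) \<Rightarrow> (real \<Rightarrow> real) \<Rightarrow>
     (int \<Rightarrow> 'n::finite) \<Rightarrow> real \<Rightarrow> real" where
  "zeta_fn A I \<phi> \<tau> w x =
     - (\<Sum>m. let k = int (Suc m) in
          deriv_within (I (w 0)) (phi_word \<phi> w 0 k) x
          * deriv_within (ifs_image A I \<phi>) \<tau> (phi_word \<phi> w 0 k x))"

definition xi_pt ::
    "real^'n^'n \<Rightarrow> ('n \<Rightarrow> real set) \<Rightarrow> ('n \<Rightarrow> 'n \<Rightarrow> real \<Rightarrow> real) \<Rightarrow> (real \<Rightarrow> real) \<Rightarrow>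
     (int \<Rightarrow> 'n::finite) \<Rightarrow> real" where
  "xi_pt A I \<phi> \<tau> w = zeta_fn A I \<phi> \<tau> w (x_pt I \<phi> w)"


section \<open>Elementary operators and their canonical maps\<close>

text \<open>Composition and multiplication operators whose symbol is only defined on a set \<open>S\<close> produce
  functions that are extended by zero outside \<open>f ` S\<close>, respectively \<open>S\<close>.\<close>

definition dil_op :: "real \<Rightarrow> (real \<Rightarrow> complex) \<Rightarrow> real \<Rightarrow> complex" where
  "dil_op s g = (\<lambda>y. g (exp s * y))"

definition trans_op :: "real \<Rightarrow> (real \<Rightarrow> complex) \<Rightarrow> real \<Rightarrow> complex" where
  "trans_op x g = (\<lambda>y. g (y - x))"

definition comp_op :: "real set \<Rightarrow> (real \<Rightarrow> real) \<Rightarrow> (real \<Rightarrow> complex) \<Rightarrow> real \<Rightarrow> complex" where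
  "comp_op S f g = (\<lambda>y. if y \<in> f ` S then g (inv_into S f y) else 0)"

definition mult_op ::
    "real \<Rightarrow> real set \<Rightarrow> (real \<Rightarrow> complex) \<Rightarrow> (real \<Rightarrow> complex) \<Rightarrow> real \<Rightarrow> complex" where
  "mult_op \<nu> S \<Upsilon> g = (\<lambda>y. if y \<in> S then exp (\<i> * of_real \<nu> * \<Upsilon> y) * g y else 0)"

definition trans_map :: "real \<Rightarrow> real \<times> real \<Rightarrow> real \<times> real" where
  "trans_map x = (\<lambda>(y, \<xi>). (y + x, \<xi>))"

definition comp_map :: "real set \<Rightarrow> (real \<Rightarrow> real) \<Rightarrow> real \<times> real \<Rightarrow> real \<times> real" where
  "comp_map S f = (\<lambda>(x, \<xi>). (f x, inverse (deriv_within S f x) * \<xi>))"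

text \<open>Only the real part \<open>\<Upsilon>0\<close> of the symbol contributes to the canonical map of \<open>mult_op\<close>.\<close>

definition mult_map :: "real set \<Rightarrow> (real \<Rightarrow> real) \<Rightarrow> real \<times> real \<Rightarrow> real \<times> real" where
  "mult_map S \<Upsilon>0 = (\<lambda>(x, \<xi>). (x, \<xi> + deriv_within S \<Upsilon>0 x))"

definition symbol :: "real \<Rightarrow> (real \<Rightarrow> real) \<Rightarrow> (real \<Rightarrow> real) \<Rightarrow> real \<Rightarrow> complex" where
  "symbol \<nu> \<Upsilon>0 \<Upsilon>1 = (\<lambda>y. of_real (\<Upsilon>0 y) + \<i> / of_real \<nu> * of_real (\<Upsilon>1 y))"

text \<open>Here \<open>S\<close> is the domain of the symbol \<open>\<Upsilon>\<close> and \<open>J\<close> the domain of \<open>H\<close>.\<close>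

definition normal_op ::
    "real \<Rightarrow> real set \<Rightarrow> (real \<Rightarrow> complex) \<Rightarrow> real \<Rightarrow> real set \<Rightarrow> (real \<Rightarrow> real) \<Rightarrow>
     (real \<Rightarrow> complex) \<Rightarrow> real \<Rightarrow> complex" where
  "normal_op \<nu> S \<Upsilon> x J H = mult_op \<nu> S \<Upsilon> \<circ> trans_op x \<circ> comp_op J H"

definition normal_map ::
    "real set \<Rightarrow> (real \<Rightarrow> real) \<Rightarrow> real \<Rightarrow> real set \<Rightarrow> (real \<Rightarrow> real) \<Rightarrow>
     real \<times> real \<Rightarrow> real \<times> real" where
  "normal_map S \<Upsilon>0 x J H = mult_map S \<Upsilon>0 \<circ> trans_map x \<circ> comp_map J H"

text \<open>The operator identity on \<open>C0inf U\<close>. The inverse of \<open>T\<close> is its inverse as a map on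
  \<open>C0inf J\<close>; for this to make sense, \<open>T\<close> has to be injective there and its range has to contain
  \<open>C0inf U\<close>, so both are part of the claim.\<close>

definition conjugates_on ::
    "real set \<Rightarrow> real set \<Rightarrow> ((real \<Rightarrow> complex) \<Rightarrow> real \<Rightarrow> complex) \<Rightarrow> complex \<Rightarrow>
     ((real \<Rightarrow> complex) \<Rightarrow> real \<Rightarrow> complex) \<Rightarrow> real \<Rightarrow> ((real \<Rightarrow> complex) \<Rightarrow> real \<Rightarrow> complex) \<Rightarrow> bool" where
  "conjugates_on U J L c T' s T \<longleftrightarrow>
     inj_on T (C0inf J) \<and> C0inf U \<subseteq> T ` C0inf J \<and>
     (\<forall>f\<in>C0inf U. L f = (\<lambda>x. c * (T' \<circ> dil_op s \<circ> inv_into (C0inf J) T) f x))"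

end

theory Submission
  imports Defs
begin

text \<open>
  Every branch of the system contracts, so along the future \<open>w\<^sub>0, w\<^sub>1, \<dots>\<close> of a word the dynamics
  near the base point \<open>x\<^sub>w\<close> can be linearised and the weights \<open>\<tau>\<close>, \<open>V\<close> can be reduced to
  constants, both on the whole interval \<open>I\<^bsub>w\<^sub>0\<^esub>\<close>. Everything is built from one kind of series. Let
  \<open>F\<^sub>k\<close> be the composition of the first \<open>k\<close> branches; the Birkhoff sum

  \<open>B\<^sub>w g (x) = \<Sum>\<^sub>k g (F\<^sub>k x) - g (F\<^sub>k x\<^sub>w)\<close>

  converges because \<open>F\<^sub>k\<close> contracts by \<open>\<theta>\<^sup>k\<close>. Splitting off the term \<open>k = 0\<close> shows that
  \<open>B\<^sub>w g (x) = g x - g x\<^sub>w + B\<^bsub>Lw\<^esub> g (\<phi> x)\<close> for the first branch \<open>\<phi>\<close>, that is, \<open>g\<close> equals the constant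
  \<open>g x\<^sub>w\<close> up to a coboundary.

  For \<open>g = \<tau> \<circ> \<phi>\<close> and \<open>g = V \<circ> \<phi>\<close> this yields \<open>\<Upsilon>\<^sup>(\<^sup>0\<^sup>) = - B\<^sub>w (\<tau> \<circ> \<phi>)\<close>, whose derivative is
  \<open>\<zeta>\<^sub>w\<close> term by term, and \<open>\<Upsilon>\<^sup>(\<^sup>1\<^sup>) = B\<^sub>w (V \<circ> \<phi>)\<close>. For \<open>g = ln \<phi>'\<close> it yields the linearising chart
  \<open>h\<^sub>w\<close>, the primitive of \<open>exp (B\<^sub>w (ln \<phi>'))\<close> that vanishes at \<open>x\<^sub>w\<close>: the cocycle identity says that
  \<open>h\<^bsub>Lw\<^esub> \<circ> \<phi>\<close> and \<open>\<phi>' (x\<^sub>w) h\<^sub>w\<close> have the same derivative, and they agree at \<open>x\<^sub>w\<close>. The map \<open>H\<^sub>w\<close> of the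
  normal form is \<open>h\<^sub>w\<^sup>-\<^sup>1 - x\<^sub>w\<close>. All images \<open>h\<^sub>w (I\<^bsub>w\<^sub>0\<^esub>)\<close> contain one common interval \<open>(- \<delta>, \<delta>)\<close>, because
  \<open>x\<^sub>w\<close> keeps a uniform distance from the boundary and \<open>h\<^sub>w'\<close> is bounded below.

  The remaining work is the uniformity in \<open>w\<close> of all derivative bounds. It is handled by a predicate
  on whole families of functions, \<open>tame m\<close>, which is stable under products, compositions,
  exponentials, inverses, primitives and geometric series; with these rules each bound follows by a
  short bootstrap on the order of differentiation (\<open>tame_dorbit\<close> for \<open>F\<^sub>k'\<close>, \<open>tame_birkhoff\<close> for the
  series, \<open>tame_lin_inv'\<close> for the inverse chart). In terms of the chart the operators of
  the normal form are \<open>g \<mapsto> e\<^bsup>i\<nu>\<Upsilon>\<^esup> (g \<circ> h\<^sub>w)\<close>, so the operator identity (\<open>conjugation\<close>) is then a pointwise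
  computation with the three cocycle identities.
\<close>

section \<open>Families of functions with uniformly bounded derivatives\<close>

definition unif_bdd ::
    "'p set \<Rightarrow> ('p \<Rightarrow> real set) \<Rightarrow> ('p \<Rightarrow> real) \<Rightarrow> ('p \<Rightarrow> real \<Rightarrow> 'a::real_normed_vector) \<Rightarrow> bool" where
  "unif_bdd P S r f \<longleftrightarrow> (\<exists>C. \<forall>p\<in>P. \<forall>x\<in>S p. norm (f p x) \<le> C * r p)"

definition fam_deriv ::
    "'p set \<Rightarrow> ('p \<Rightarrow> real set) \<Rightarrow> ('p \<Rightarrow> real \<Rightarrow> 'a::real_normed_vector) \<Rightarrow> ('p \<Rightarrow> real \<Rightarrow> 'a) \<Rightarrow> bool" where
  "fam_deriv P S f f' \<longleftrightarrow> (\<forall>p\<in>P. \<forall>x\<in>S p. (f p has_vector_derivative f' p x) (at x within S p))"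

text \<open>The recursion asks for a derivative family that is again tame, rather than for bounds on iterated
derivatives: products, compositions and series can then be treated by induction on \<open>m\<close> with the
ordinary first-order rules, without the formulas of Leibniz and Faa di Bruno. The weight \<open>r\<close>
records decay such as \<open>\<theta>\<^sup>k\<close>; the constants at different orders are unrelated.\<close>

primrec tame ::
    "nat \<Rightarrow> 'p set \<Rightarrow> ('p \<Rightarrow> real set) \<Rightarrow> ('p \<Rightarrow> real) \<Rightarrow> ('p \<Rightarrow> real \<Rightarrow> 'a::real_normed_vector) \<Rightarrow> bool" where
  "tame 0 P S r f \<longleftrightarrow> unif_bdd P S r f"
| "tame (Suc m) P S r f \<longleftrightarrow> unif_bdd P S r f \<and> (\<exists>f'. fam_deriv P S f f' \<and> tame m P S r f')"

lemma unif_bddI: "(\<And>p x. p \<in> P \<Longrightarrow> x \<in> S p \<Longrightarrow> norm (f p x) \<le> C * r p) \<Longrightarrow> unif_bdd P S r f"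
  unfolding unif_bdd_def by blast

lemma unif_bddE:
  assumes "unif_bdd P S r f"
  obtains C where "C \<ge> 0" "\<And>p x. p \<in> P \<Longrightarrow> x \<in> S p \<Longrightarrow> norm (f p x) \<le> C * \<bar>r p\<bar>"
proof -
  obtain C where C: "\<forall>p\<in>P. \<forall>x\<in>S p. norm (f p x) \<le> C * r p"
    using assms unfolding unif_bdd_def by blast
  have "norm (f p x) \<le> \<bar>C\<bar> * \<bar>r p\<bar>" if "p \<in> P" "x \<in> S p" for p x
    using C that by (metis abs_ge_self abs_mult order_trans)
  then show thesis by (intro that[of "\<bar>C\<bar>"]) auto
qed

lemma fam_derivI:
  "(\<And>p x. p \<in> P \<Longrightarrow> x \<in> S p \<Longrightarrow> (f p has_vector_derivative f' p x) (at x within S p)) \<Longrightarrow> fam_deriv P S f f'"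
  unfolding fam_deriv_def by blast

lemma fam_derivD:
  "fam_deriv P S f f' \<Longrightarrow> p \<in> P \<Longrightarrow> x \<in> S p \<Longrightarrow> (f p has_vector_derivative f' p x) (at x within S p)"
  unfolding fam_deriv_def by blast

lemma fam_deriv_realD:
  "fam_deriv P S f f' \<Longrightarrow> p \<in> P \<Longrightarrow> x \<in> S p \<Longrightarrow> (f p has_real_derivative f' p x) (at x within S p)"
  unfolding fam_deriv_def has_real_derivative_iff_has_vector_derivative by blast

lemma tame_SucI: "unif_bdd P S r f \<Longrightarrow> fam_deriv P S f f' \<Longrightarrow> tame m P S r f' \<Longrightarrow> tame (Suc m) P S r f"
  by auto

lemma tame_bdd: "tame m P S r f \<Longrightarrow> unif_bdd P S r f"
  by (cases m) auto

lemma tame_Suc_imp: "tame (Suc m) P S r f \<Longrightarrow> tame m P S r f"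
proof (induction m arbitrary: f)
  case (Suc m)
  then show ?case by (metis tame.simps(2))
qed simp

lemma tame_cong:
  assumes "\<And>p x. p \<in> P \<Longrightarrow> x \<in> S p \<Longrightarrow> f p x = g p x" and "tame m P S r f"
  shows "tame m P S r g"
proof -
  have b: "unif_bdd P S r f \<Longrightarrow> unif_bdd P S r g"
    unfolding unif_bdd_def using assms(1) by auto
  have d: "fam_deriv P S f f' \<Longrightarrow> fam_deriv P S g f'" for f'
    unfolding fam_deriv_def
    by (auto intro: has_vector_derivative_transform[where f = "f _"] simp: assms(1)[symmetric])
  show ?thesis using assms(2) b d by (cases m) auto
qed

lemma tame_subset:
  assumes "tame m Q S r f" "P \<subseteq> Q"
  shows "tame m P S r f"
  using assms(1)
proof (induction m arbitrary: f)
  case 0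
  then show ?case using assms(2) by (auto simp: unif_bdd_def)
next
  case (Suc m)
  then show ?case using assms(2) unfolding tame.simps unif_bdd_def fam_deriv_def by blast
qed

lemma tame_weaken:
  assumes "tame m P S r f" "\<And>p. p \<in> P \<Longrightarrow> \<bar>r p\<bar> \<le> s p"
  shows "tame m P S s f"
proof -
  have b: "unif_bdd P S s g" if g: "unif_bdd P S r g" for g :: "'a \<Rightarrow> real \<Rightarrow> 'b"
  proof -
    obtain C where C: "C \<ge> 0" "\<And>p x. p \<in> P \<Longrightarrow> x \<in> S p \<Longrightarrow> norm (g p x) \<le> C * \<bar>r p\<bar>"
      by (rule unif_bddE[OF g], rule that)
    show ?thesis
      by (rule unif_bddI[where C = C]) (meson C assms(2) mult_left_mono order_trans)
  qed
  show ?thesis using assms(1)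
    by (induction m arbitrary: f) (auto intro: b)
qed

lemma tame_const:
  assumes "\<And>p. p \<in> P \<Longrightarrow> norm (c p) \<le> C * r p"
  shows "tame m P S r (\<lambda>p x. c p)"
proof -
  have z: "unif_bdd P S r (\<lambda>p x. 0::'c::real_normed_vector)"
    by (rule unif_bddI[where C = 0]) simp
  have z: "tame m P S r (\<lambda>p x. 0::'b)" for m
    by (induction m) (auto simp: fam_deriv_def z intro!: exI[of _ "\<lambda>p x. 0"])
  have "unif_bdd P S r (\<lambda>p x. c p)" using assms by (intro unif_bddI)
  moreover have "fam_deriv P S (\<lambda>p x. c p) (\<lambda>p x. 0)" by (simp add: fam_deriv_def)
  ultimately show ?thesis using z by (cases m) auto
qed

lemma tame_add:
  assumes "tame m P S r f" "tame m P S r g"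
  shows "tame m P S r (\<lambda>p x. f p x + g p x)"
proof -
  have b: "unif_bdd P S r (\<lambda>p x. f p x + g p x)"
    if fg: "unif_bdd P S r f" "unif_bdd P S r g" for f g :: "'a \<Rightarrow> real \<Rightarrow> 'b"
  proof -
    obtain C where C: "\<forall>p\<in>P. \<forall>x\<in>S p. norm (f p x) \<le> C * r p"
      using fg(1) unfolding unif_bdd_def by blast
    obtain D where D: "\<forall>p\<in>P. \<forall>x\<in>S p. norm (g p x) \<le> D * r p"
      using fg(2) unfolding unif_bdd_def by blast
    show ?thesis
      by (rule unif_bddI[where C = "C + D"])
         (use C D in \<open>auto simp: distrib_right intro!: order_trans[OF norm_triangle_ineq add_mono]\<close>)
  qed
  show ?thesis using assms
  proof (induction m arbitrary: f g)
    case (Suc m)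
    then obtain f' g' where "fam_deriv P S f f'" "fam_deriv P S g g'" "tame m P S r f'" "tame m P S r g'"
      by auto
    with Suc show ?case
      by (intro tame_SucI[where f' = "\<lambda>p x. f' p x + g' p x"])
         (auto simp: fam_deriv_def intro!: has_vector_derivative_add b)
  qed (auto intro: b)
qed

lemma tame_bilinear:
  fixes B :: "'a::real_normed_vector \<Rightarrow> 'b::real_normed_vector \<Rightarrow> 'c::real_normed_vector"
  assumes B: "bounded_bilinear B" and "tame m P S r f" "tame m P S s g"
  shows "tame m P S (\<lambda>p. r p * s p) (\<lambda>p x. B (f p x) (g p x))"
proof -
  obtain K where K: "K > 0" "\<And>a b. norm (B a b) \<le> norm a * norm b * K"
    using bounded_bilinear.pos_bounded[OF B] by blast
  have b: "unif_bdd P S (\<lambda>p. r p * s p) (\<lambda>p x. B (f p x) (g p x))"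
    if fg: "unif_bdd P S r f" "unif_bdd P S s g" for f g
  proof -
    obtain C where C: "\<forall>p\<in>P. \<forall>x\<in>S p. norm (f p x) \<le> C * r p"
      using fg(1) unfolding unif_bdd_def by blast
    obtain D where D: "\<forall>p\<in>P. \<forall>x\<in>S p. norm (g p x) \<le> D * s p"
      using fg(2) unfolding unif_bdd_def by blast
    have "norm (B (f p x) (g p x)) \<le> (C * D * K) * (r p * s p)" if "p \<in> P" "x \<in> S p" for p x
    proof -
      have "norm (f p x) * norm (g p x) \<le> (C * r p) * (D * s p)"
        using C D that by (intro mult_mono) (auto intro: order_trans[OF norm_ge_zero])
      then have "norm (f p x) * norm (g p x) * K \<le> (C * r p) * (D * s p) * K"
        using K(1) by simp
      then show ?thesis using K(2)[of "f p x" "g p x"] by (simp add: mult_ac)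
    qed
    then show ?thesis by (rule unif_bddI)
  qed
  show ?thesis using assms(2,3)
  proof (induction m arbitrary: f g)
    case (Suc m)
    then obtain f' g' where d: "fam_deriv P S f f'" "fam_deriv P S g g'"
      and t: "tame m P S r f'" "tame m P S s g'"
      by auto
    have "tame m P S r f" "tame m P S s g" using Suc.prems by (auto dest: tame_Suc_imp simp del: tame.simps)
    then have "tame m P S (\<lambda>p. r p * s p) (\<lambda>p x. B (f p x) (g' p x) + B (f' p x) (g p x))"
      using t Suc.IH by (intro tame_add) auto
    then show ?case
      using d Suc.prems
      by (intro tame_SucI[OF b])
         (auto simp: fam_deriv_def intro!: bounded_bilinear.has_vector_derivative[OF B])
  qed (auto intro: b)
qed

lemmas tame_mult = tame_bilinear[OF bounded_bilinear_mult]
lemmas tame_scaleR = tame_bilinear[OF bounded_bilinear_scaleR]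

lemma tame_mult_1:
  fixes f g :: "'p \<Rightarrow> real \<Rightarrow> 'a::real_normed_algebra"
  assumes "tame m P S (\<lambda>_. 1) f" "tame m P S r g"
  shows "tame m P S r (\<lambda>p x. f p x * g p x)"
  using tame_mult[OF assms] by simp

lemma tame_cmult:
  fixes f :: "'p \<Rightarrow> real \<Rightarrow> 'a::real_normed_algebra"
  assumes "tame m P S r f"
  shows "tame m P S r (\<lambda>p x. c * f p x)"
  by (rule tame_mult_1[OF tame_const[where C = "norm c"] assms]) simp

lemma tame_of_real:
  fixes f :: "'p \<Rightarrow> real \<Rightarrow> real"
  assumes "tame m P S r f"
  shows "tame m P S r (\<lambda>p x. of_real (f p x) :: 'a::real_normed_algebra_1)"
  using tame_scaleR[OF assms tame_const[where c = "\<lambda>_. 1::'a" and C = 1 and r = "\<lambda>_. 1"]]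
  by (simp add: of_real_def)

text \<open>The derivative of \<open>f \<circ> F\<close> is \<open>F' \<cdot> (f' \<circ> F)\<close>, so order \<open>m\<close> of the composition uses \<open>F'\<close> only up to
order \<open>m - 1\<close>. This gap of one order is what makes bootstrapping possible when \<open>F'\<close> is itself given
in terms of \<open>F\<close>.\<close>

lemma tame_compose:
  fixes f :: "'q \<Rightarrow> real \<Rightarrow> 'a::real_normed_vector" and F :: "'p \<Rightarrow> real \<Rightarrow> real"
  assumes "tame m Q S r f"
    and \<sigma>: "\<And>p. p \<in> P \<Longrightarrow> \<sigma> p \<in> Q" "\<And>p x. p \<in> P \<Longrightarrow> x \<in> T p \<Longrightarrow> F p x \<in> S (\<sigma> p)"
    and F': "fam_deriv P T F F'" "\<And>k. k < m \<Longrightarrow> tame k P T (\<lambda>_. 1) F'"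
  shows "tame m P T (\<lambda>p. r (\<sigma> p)) (\<lambda>p x. f (\<sigma> p) (F p x))"
proof -
  have b: "unif_bdd P T (\<lambda>p. r (\<sigma> p)) (\<lambda>p x. f (\<sigma> p) (F p x))"
    if "unif_bdd Q S r f" for f :: "'q \<Rightarrow> real \<Rightarrow> 'a"
    using that \<sigma> unfolding unif_bdd_def by meson
  show ?thesis using assms(1) F'(2)
  proof (induction m arbitrary: f)
    case (Suc m)
    then obtain f' where d: "fam_deriv Q S f f'" and t: "tame m Q S r f'" by auto
    have "tame m P T (\<lambda>p. 1 * r (\<sigma> p)) (\<lambda>p x. F' p x *\<^sub>R f' (\<sigma> p) (F p x))"
      using Suc t by (intro tame_scaleR) auto
    moreover have "fam_deriv P T (\<lambda>p x. f (\<sigma> p) (F p x)) (\<lambda>p x. F' p x *\<^sub>R f' (\<sigma> p) (F p x))"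
    proof (rule fam_derivI)
      fix p x assume p: "p \<in> P" "x \<in> T p"
      have "(f (\<sigma> p) has_vector_derivative f' (\<sigma> p) (F p x)) (at (F p x) within F p ` T p)"
        by (rule has_vector_derivative_within_subset[OF fam_derivD[OF d]]) (use p \<sigma> in auto)
      then show "((\<lambda>x. f (\<sigma> p) (F p x)) has_vector_derivative F' p x *\<^sub>R f' (\<sigma> p) (F p x)) (at x within T p)"
        using vector_diff_chain_within[OF fam_derivD[OF F'(1) p]] by (simp add: o_def)
    qed
    ultimately show ?case using Suc.prems(1) by (intro tame_SucI[OF b]) auto
  qed (auto intro: b)
qed

text \<open>Bootstrap: \<open>(exp f)' = f' \<cdot> exp f\<close> expresses the next order through the previous one.\<close>

lemma tame_exp:
  fixes f :: "'p \<Rightarrow> real \<Rightarrow> 'a::{real_normed_field,banach}"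
  assumes "tame m P S (\<lambda>_. 1) f"
  shows "tame m P S (\<lambda>_. 1) (\<lambda>p x. exp (f p x))"
proof -
  have b: "unif_bdd P S (\<lambda>_. 1) (\<lambda>p x. exp (f p x))"
  proof -
    obtain C where "C \<ge> 0" and C: "\<And>p x. p \<in> P \<Longrightarrow> x \<in> S p \<Longrightarrow> norm (f p x) \<le> C * \<bar>1\<bar>"
      by (rule unif_bddE[OF tame_bdd[OF assms]], rule that)
    show ?thesis
      by (rule unif_bddI[where C = "exp C"]) (use C in \<open>auto intro: order_trans[OF norm_exp]\<close>)
  qed
  show ?thesis using assms
  proof (induction m)
    case (Suc m)
    then obtain f' where d: "fam_deriv P S f f'" and t: "tame m P S (\<lambda>_. 1) f'" by auto
    have "fam_deriv P S (\<lambda>p x. exp (f p x)) (\<lambda>p x. f' p x * exp (f p x))"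
    proof (rule fam_derivI)
      fix p x assume p: "p \<in> P" "x \<in> S p"
      show "((\<lambda>x. exp (f p x)) has_vector_derivative f' p x * exp (f p x)) (at x within S p)"
        using field_vector_diff_chain_within[OF fam_derivD[OF d p] has_field_derivative_at_within[OF DERIV_exp]]
        unfolding o_def .
    qed
    moreover have "tame m P S (\<lambda>_. 1) (\<lambda>p x. f' p x * exp (f p x))"
      using tame_mult_1[OF t Suc.IH[OF tame_Suc_imp[OF Suc.prems]]] .
    ultimately show ?case by (intro tame_SucI[OF b])
  qed (simp add: b)
qed

text \<open>The same bootstrap, with \<open>(1/f)' = - (1/f) (1/f) f'\<close>.\<close>

lemma tame_inverse:
  fixes f :: "'p \<Rightarrow> real \<Rightarrow> real"
  assumes "tame m P S (\<lambda>_. 1) f" and b: "unif_bdd P S (\<lambda>_. 1) (\<lambda>p x. inverse (f p x))"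
    and nz: "\<And>p x. p \<in> P \<Longrightarrow> x \<in> S p \<Longrightarrow> f p x \<noteq> 0"
  shows "tame m P S (\<lambda>_. 1) (\<lambda>p x. inverse (f p x))"
  using assms(1)
proof (induction m)
  case (Suc m)
  then obtain f' where d: "fam_deriv P S f f'" and t: "tame m P S (\<lambda>_. 1) f'" by auto
  have i: "tame m P S (\<lambda>_. 1) (\<lambda>p x. inverse (f p x))"
    using Suc.IH[OF tame_Suc_imp[OF Suc.prems]] .
  have "fam_deriv P S (\<lambda>p x. inverse (f p x)) (\<lambda>p x. (- 1) * (inverse (f p x) * (inverse (f p x) * f' p x)))"
  proof (rule fam_derivI)
    fix p x assume p: "p \<in> P" "x \<in> S p"
    show "((\<lambda>x. inverse (f p x)) has_vector_derivative
        (- 1) * (inverse (f p x) * (inverse (f p x) * f' p x))) (at x within S p)"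
      using DERIV_inverse'[OF fam_deriv_realD[OF d p] nz[OF p]]
      unfolding has_real_derivative_iff_has_vector_derivative
      by (simp only: mult_ac mult_minus_left mult_1_left)
  qed
  moreover have "tame m P S (\<lambda>_. 1) (\<lambda>p x. (- 1) * (inverse (f p x) * (inverse (f p x) * f' p x)))"
    by (intro tame_cmult tame_mult_1 i t)
  ultimately show ?case by (intro tame_SucI[OF b])
qed (simp add: b)

text \<open>Only the bound of order \<open>0\<close> is new, and it comes from the mean value inequality, starting from the
zero \<open>c p\<close>.\<close>

lemma tame_primitive:
  fixes f f' :: "'p \<Rightarrow> real \<Rightarrow> real"
  assumes t: "tame m P S r f'" and d: "fam_deriv P S f f'"
    and c: "\<And>p. p \<in> P \<Longrightarrow> c p \<in> S p" "\<And>p. p \<in> P \<Longrightarrow> f p (c p) = 0"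
    and S: "\<And>p. p \<in> P \<Longrightarrow> convex (S p)" "\<And>p x. p \<in> P \<Longrightarrow> x \<in> S p \<Longrightarrow> \<bar>x - c p\<bar> \<le> D"
    and r: "\<And>p. p \<in> P \<Longrightarrow> 0 \<le> r p"
  shows "tame (Suc m) P S r f"
proof (rule tame_SucI[OF _ d t])
  obtain C where C: "C \<ge> 0" "\<And>p x. p \<in> P \<Longrightarrow> x \<in> S p \<Longrightarrow> norm (f' p x) \<le> C * \<bar>r p\<bar>"
    by (rule unif_bddE[OF tame_bdd[OF t]], rule that)
  show "unif_bdd P S r f"
  proof (rule unif_bddI[where C = "C * D"])
    fix p x assume p: "p \<in> P" "x \<in> S p"
    have "norm (f p x - f p (c p)) \<le> (C * \<bar>r p\<bar>) * norm (x - c p)"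
      by (rule field_differentiable_bound[OF S(1) fam_deriv_realD[OF d]]) (use p C c in auto)
    also have "\<dots> \<le> (C * \<bar>r p\<bar>) * D"
      using S(2)[OF p] C(1) by (intro mult_left_mono) auto
    finally show "norm (f p x) \<le> C * D * r p"
      using c(2)[OF p(1)] r[OF p(1)] by (simp add: mult_ac)
  qed
qed

lemma tame_partial_sums:
  fixes f :: "'p \<times> nat \<Rightarrow> real \<Rightarrow> 'a::real_normed_vector"
  assumes "tame m (P \<times> UNIV) (\<lambda>q. S (fst q)) (\<lambda>q. \<theta> ^ snd q) f" and \<theta>: "0 \<le> \<theta>" "\<theta> < 1"
  shows "tame m (P \<times> UNIV) (\<lambda>q. S (fst q)) (\<lambda>_. 1) (\<lambda>q x. \<Sum>k<snd q. f (fst q, k) x)"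
proof -
  have b: "unif_bdd (P \<times> UNIV) (\<lambda>q. S (fst q)) (\<lambda>_. 1) (\<lambda>q x. \<Sum>k<snd q. f (fst q, k) x)"
    if f: "unif_bdd (P \<times> UNIV) (\<lambda>q. S (fst q)) (\<lambda>q. \<theta> ^ snd q) f" for f :: "'p \<times> nat \<Rightarrow> real \<Rightarrow> 'a"
  proof -
    obtain C where C: "C \<ge> 0" "\<And>q x. q \<in> P \<times> UNIV \<Longrightarrow> x \<in> S (fst q) \<Longrightarrow> norm (f q x) \<le> C * \<bar>\<theta> ^ snd q\<bar>"
      by (rule unif_bddE[OF f], rule that)
    show ?thesis
    proof (rule unif_bddI[where C = "C * (\<Sum>k. \<theta> ^ k)"])
      fix q :: "'p \<times> nat" and x assume q: "q \<in> P \<times> UNIV" "x \<in> S (fst q)"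
      have "norm (\<Sum>k<snd q. f (fst q, k) x) \<le> (\<Sum>k<snd q. norm (f (fst q, k) x))" by (rule norm_sum)
      also have "\<dots> \<le> (\<Sum>k<snd q. C * \<theta> ^ k)"
        using C(2)[of "(fst q, _)" x] q \<theta> by (intro sum_mono) (auto simp: mem_Times_iff)
      also have "\<dots> = C * (\<Sum>k<snd q. \<theta> ^ k)" by (simp add: sum_distrib_left)
      also have "\<dots> \<le> C * (\<Sum>k. \<theta> ^ k)"
        using \<theta> C(1) by (intro mult_left_mono sum_le_suminf summable_geometric) auto
      finally show "norm (\<Sum>k<snd q. f (fst q, k) x) \<le> C * (\<Sum>k. \<theta> ^ k) * 1" by simp
    qed
  qed
  show ?thesis using assms(1)
  proof (induction m arbitrary: f)
    case (Suc m)
    then obtain f' where d: "fam_deriv (P \<times> UNIV) (\<lambda>q. S (fst q)) f f'"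
      and t: "tame m (P \<times> UNIV) (\<lambda>q. S (fst q)) (\<lambda>q. \<theta> ^ snd q) f'" by auto
    have "fam_deriv (P \<times> UNIV) (\<lambda>q. S (fst q)) (\<lambda>q x. \<Sum>k<snd q. f (fst q, k) x) (\<lambda>q x. \<Sum>k<snd q. f' (fst q, k) x)"
      using fam_derivD[OF d] by (intro fam_derivI has_vector_derivative_sum) (force simp: mem_Times_iff)
    then show ?case using Suc t by (intro tame_SucI[OF b]) auto
  qed (auto intro: b)
qed

text \<open>The weights \<open>\<theta>\<^sup>k\<close> give uniform convergence of the differentiated series by the Weierstrass test.\<close>

lemma geometric_series_deriv:
  fixes f f' :: "'p \<times> nat \<Rightarrow> real \<Rightarrow> real"
  assumes f: "unif_bdd (P \<times> UNIV) (\<lambda>q. S (fst q)) (\<lambda>q. \<theta> ^ snd q) f"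
    and f': "unif_bdd (P \<times> UNIV) (\<lambda>q. S (fst q)) (\<lambda>q. \<theta> ^ snd q) f'"
    and d: "fam_deriv (P \<times> UNIV) (\<lambda>q. S (fst q)) f f'"
    and \<theta>: "0 \<le> \<theta>" "\<theta> < 1" and S: "\<And>p. p \<in> P \<Longrightarrow> convex (S p)"
  shows "fam_deriv P S (\<lambda>p x. \<Sum>k. f (p, k) x) (\<lambda>p x. \<Sum>k. f' (p, k) x)"
proof (rule fam_derivI)
  fix p x assume p: "p \<in> P" "x \<in> S p"
  obtain C where C: "C \<ge> 0" "\<And>q x. q \<in> P \<times> UNIV \<Longrightarrow> x \<in> S (fst q) \<Longrightarrow> norm (f q x) \<le> C * \<bar>\<theta> ^ snd q\<bar>"
    by (rule unif_bddE[OF f], rule that)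
  obtain D where D: "D \<ge> 0" "\<And>q x. q \<in> P \<times> UNIV \<Longrightarrow> x \<in> S (fst q) \<Longrightarrow> norm (f' q x) \<le> D * \<bar>\<theta> ^ snd q\<bar>"
    by (rule unif_bddE[OF f'], rule that)
  have g: "summable (\<lambda>k. E * \<theta> ^ k)" for E
    using \<theta> by (intro summable_mult summable_geometric) auto
  have u: "uniform_limit (S p) (\<lambda>n x. \<Sum>i<n. f' (p, i) x) (\<lambda>x. \<Sum>k. f' (p, k) x) sequentially"
    using D(2)[of "(p, _)"] p \<theta> by (intro Weierstrass_m_test[OF _ g]) auto
  have s: "summable (\<lambda>n. f (p, n) x)"
    using C(2)[of "(p, _)" x] p \<theta> by (intro summable_comparison_test'[OF g]) auto
  have dk: "(f (p, k) has_real_derivative f' (p, k) y) (at y within S p)" if "y \<in> S p" for k y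
    using fam_deriv_realD[OF d, of "(p, k)" y] p(1) that by simp
  obtain g where g: "\<And>y. y \<in> S p \<Longrightarrow> (\<lambda>n. f (p, n) y) sums g y"
      "\<And>y. y \<in> S p \<Longrightarrow> (g has_field_derivative (\<Sum>k. f' (p, k) y)) (at y within S p)"
    using has_field_derivative_series[OF S[OF p(1)] dk u p(2) s] by blast
  have "((\<lambda>x. \<Sum>k. f (p, k) x) has_field_derivative (\<Sum>k. f' (p, k) x)) (at x within S p)"
    by (rule has_field_derivative_transform_within[OF g(2)[OF p(2)] zero_less_one p(2)])
       (simp add: sums_unique[OF g(1)])
  then show "((\<lambda>x. \<Sum>k. f (p, k) x) has_vector_derivative (\<Sum>k. f' (p, k) x)) (at x within S p)"
    by (simp add: has_real_derivative_iff_has_vector_derivative)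
qed

lemma tame_series:
  fixes f :: "'p \<times> nat \<Rightarrow> real \<Rightarrow> real"
  assumes "tame m (P \<times> UNIV) (\<lambda>q. S (fst q)) (\<lambda>q. \<theta> ^ snd q) f" and \<theta>: "0 \<le> \<theta>" "\<theta> < 1"
    and S: "\<And>p. p \<in> P \<Longrightarrow> convex (S p)"
  shows "tame m P S (\<lambda>_. 1) (\<lambda>p x. \<Sum>k. f (p, k) x)"
proof -
  have b: "unif_bdd P S (\<lambda>_. 1) (\<lambda>p x. \<Sum>k. f (p, k) x)"
    if f: "unif_bdd (P \<times> UNIV) (\<lambda>q. S (fst q)) (\<lambda>q. \<theta> ^ snd q) f" for f :: "'p \<times> nat \<Rightarrow> real \<Rightarrow> real"
  proof -
    obtain C where C: "C \<ge> 0" "\<And>q x. q \<in> P \<times> UNIV \<Longrightarrow> x \<in> S (fst q) \<Longrightarrow> norm (f q x) \<le> C * \<bar>\<theta> ^ snd q\<bar>"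
      by (rule unif_bddE[OF f], rule that)
    have g: "summable (\<lambda>k. C * \<theta> ^ k)"
      using \<theta> by (intro summable_mult summable_geometric) auto
    show ?thesis
    proof (rule unif_bddI[where C = "\<Sum>k. C * \<theta> ^ k"])
      fix p x assume p: "p \<in> P" "x \<in> S p"
      show "norm (\<Sum>k. f (p, k) x) \<le> (\<Sum>k. C * \<theta> ^ k) * 1"
        using norm_suminf_le[OF _ g, of "\<lambda>k. f (p, k) x"] C(2)[of "(p, _)" x] p \<theta> by simp
    qed
  qed
  show ?thesis using assms(1)
  proof (induction m arbitrary: f)
    case (Suc m)
    then obtain f' where d: "fam_deriv (P \<times> UNIV) (\<lambda>q. S (fst q)) f f'"
      and t: "tame m (P \<times> UNIV) (\<lambda>q. S (fst q)) (\<lambda>q. \<theta> ^ snd q) f'" by auto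
    have "fam_deriv P S (\<lambda>p x. \<Sum>k. f (p, k) x) (\<lambda>p x. \<Sum>k. f' (p, k) x)"
      using Suc.prems t by (intro geometric_series_deriv[OF _ tame_bdd d \<theta> S]) auto
    then show ?case using Suc t by (intro tame_SucI[OF b]) auto
  qed (auto intro: b)
qed

section \<open>Smooth functions\<close>

lemma deriv_within_works:
  "f differentiable_on S \<Longrightarrow> x \<in> S \<Longrightarrow> (f has_vector_derivative deriv_within S f x) (at x within S)"
  unfolding deriv_within_def differentiable_on_def by (simp add: vector_derivative_works)

lemma differentiable_on_cong:
  assumes "\<And>x. x \<in> S \<Longrightarrow> f x = g x" "f differentiable_on S"
  shows "g differentiable_on S"
  unfolding differentiable_on_def
proof
  fix x assume x: "x \<in> S"
  then have "f differentiable at x within S" using assms(2) by (simp add: differentiable_on_def)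
  from differentiable_transform_within[OF this zero_less_one x] show "g differentiable at x within S"
    using assms(1) by simp
qed

lemma deriv_within_eq:
  "at x within S \<noteq> bot \<Longrightarrow> (f has_vector_derivative d) (at x within S) \<Longrightarrow> deriv_within S f x = d"
  unfolding deriv_within_def by (rule vector_derivative_within)

lemma deriv_within_cong:
  assumes "\<And>x. x \<in> S \<Longrightarrow> f x = g x" "x \<in> S"
  shows "deriv_within S f x = deriv_within S g x"
  unfolding deriv_within_def
  by (rule vector_derivative_cong_eq) (use assms in auto)

lemma nderiv_0 [simp]: "nderiv S 0 f = f" by (simp add: nderiv_def)

lemma nderiv_Suc: "nderiv S (Suc n) f = nderiv S n (deriv_within S f)"
  by (simp only: nderiv_def funpow_Suc_right o_apply)

lemma nderiv_cong:
  assumes "\<And>x. x \<in> S \<Longrightarrow> f x = g x" "x \<in> S"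
  shows "nderiv S n f x = nderiv S n g x"
  using assms
proof (induction n arbitrary: f g x)
  case (Suc n)
  show ?case unfolding nderiv_Suc
    by (rule Suc.IH[OF _ Suc.prems(2)]) (rule deriv_within_cong[OF Suc.prems(1)])
qed simp

lemma smooth_on_differentiable: "smooth_on S f \<Longrightarrow> f differentiable_on S"
  unfolding smooth_on_def by (metis nderiv_0)

lemma smooth_on_deriv: "smooth_on S f \<Longrightarrow> smooth_on S (deriv_within S f)"
  unfolding smooth_on_def by (metis nderiv_Suc)

lemma smooth_on_continuous: "smooth_on S f \<Longrightarrow> continuous_on S f"
  by (simp add: smooth_on_differentiable differentiable_imp_continuous_on)

text \<open>Where points of the domain are limit points, derivatives within it are unique, so the derivative
families in the recursion of \<open>tame\<close> are the iterated derivatives.\<close>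

lemma tame_nderiv_bdd:
  assumes "tame m P S r f" and S: "\<And>p x. p \<in> P \<Longrightarrow> x \<in> S p \<Longrightarrow> at x within S p \<noteq> bot"
  shows "unif_bdd P S r (\<lambda>p. nderiv (S p) m (f p))"
  using assms(1)
proof (induction m arbitrary: f)
  case (Suc m)
  then obtain f' where d: "fam_deriv P S f f'" and t: "tame m P S r f'" by auto
  have "nderiv (S p) (Suc m) (f p) x = nderiv (S p) m (f' p) x" if "p \<in> P" "x \<in> S p" for p x
    unfolding nderiv_Suc using that fam_derivD[OF d] S
    by (intro nderiv_cong deriv_within_eq) auto
  then show ?case using Suc.IH[OF t] unfolding unif_bdd_def by simp
qed simp

lemma tame_nderiv_differentiable:
  assumes "tame (Suc m) P S r f" and S: "\<And>x. x \<in> S p \<Longrightarrow> at x within S p \<noteq> bot" and p: "p \<in> P"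
  shows "nderiv (S p) m (f p) differentiable_on S p"
  using assms(1)
proof (induction m arbitrary: f)
  case 0
  then obtain f' where "fam_deriv P S f f'" by auto
  then show ?case using p unfolding differentiable_on_def fam_deriv_def
    by (auto intro: differentiableI_vector)
next
  case (Suc m)
  then obtain f' where d: "fam_deriv P S f f'" and t: "tame (Suc m) P S r f'" by auto
  have e: "nderiv (S p) (Suc m) (f p) x = nderiv (S p) m (f' p) x" if "x \<in> S p" for x
    unfolding nderiv_Suc using that fam_derivD[OF d] S p
    by (intro nderiv_cong deriv_within_eq) auto
  show ?case by (rule differentiable_on_cong[OF _ Suc.IH[OF t]]) (simp add: e)
qed

lemma tame_smooth:
  assumes "\<And>m. tame m P S r f" and "\<And>x. x \<in> S p \<Longrightarrow> at x within S p \<noteq> bot" and "p \<in> P"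
  shows "smooth_on (S p) (f p)"
  unfolding smooth_on_def using tame_nderiv_differentiable[OF assms] by blast

text \<open>For a finite family on compact sets, continuity of each derivative already gives the bounds. The
functions may be smooth on larger sets \<open>X p\<close>, in which case derivatives are taken there and
restricted.\<close>

lemma smooth_tame:
  fixes f :: "'p \<Rightarrow> real \<Rightarrow> 'a::real_normed_vector"
  assumes "finite P" and S: "\<And>p. p \<in> P \<Longrightarrow> compact (S p)" "\<And>p. p \<in> P \<Longrightarrow> S p \<subseteq> X p"
    and "\<And>p. p \<in> P \<Longrightarrow> smooth_on (X p) (f p)"
  shows "tame m P S (\<lambda>_. 1) f"
proof -
  have b: "unif_bdd P S (\<lambda>_. 1) f" if f: "\<And>p. p \<in> P \<Longrightarrow> smooth_on (X p) (f p)" for f :: "'p \<Rightarrow> real \<Rightarrow> 'a"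
  proof -
    have "compact (f p ` S p)" if "p \<in> P" for p
      using S[OF that] smooth_on_continuous[OF f[OF that]]
      by (intro compact_continuous_image) (auto intro: continuous_on_subset)
    then have "bounded (\<Union>p\<in>P. f p ` S p)"
      by (intro bounded_UN[OF assms(1)] ballI compact_imp_bounded)
    then obtain B where "\<And>y. y \<in> (\<Union>p\<in>P. f p ` S p) \<Longrightarrow> norm y \<le> B"
      unfolding bounded_iff by blast
    then show ?thesis by (intro unif_bddI[where C = B]) auto
  qed
  show ?thesis using assms(4)
  proof (induction m arbitrary: f)
    case (Suc m)
    have "fam_deriv P S f (\<lambda>p. deriv_within (X p) (f p))"
    proof (rule fam_derivI)
      fix p x assume p: "p \<in> P" "x \<in> S p"
      show "(f p has_vector_derivative deriv_within (X p) (f p) x) (at x within S p)"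
        using S(2)[OF p(1)] p smooth_on_differentiable[OF Suc.prems[OF p(1)]]
        by (intro has_vector_derivative_within_subset[OF deriv_within_works]) auto
    qed
    moreover have "tame m P S (\<lambda>_. 1) (\<lambda>p. deriv_within (X p) (f p))"
      using Suc by (intro Suc.IH smooth_on_deriv)
    ultimately show ?case using b[OF Suc.prems] by (intro tame_SucI)
  qed (simp add: b)
qed

lemma smooth_on_cong:
  assumes "\<And>x. x \<in> S \<Longrightarrow> f x = g x" "smooth_on S f"
  shows "smooth_on S g"
  using assms(2) unfolding smooth_on_def
  by (auto intro: differentiable_on_cong[OF nderiv_cong[OF assms(1)]])

lemma at_within_open_neq_bot: "open S \<Longrightarrow> x \<in> S \<Longrightarrow> at (x::real) within S \<noteq> bot"
  by (simp only: at_within_open at_neq_bot not_False_eq_True)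

lemma nderiv_open:
  assumes "open S" "x \<in> S"
  shows "nderiv S n f x = nderiv UNIV n f x"
  using assms(2)
proof (induction n arbitrary: f x)
  case (Suc n)
  have e: "deriv_within S f y = deriv_within UNIV f y" if "y \<in> S" for y
    by (simp only: deriv_within_def at_within_open[OF that assms(1)])
  have "nderiv S n (deriv_within S f) x = nderiv S n (deriv_within UNIV f) x"
    by (rule nderiv_cong[OF e Suc.prems])
  then show ?case unfolding nderiv_Suc by (simp add: Suc.IH[OF Suc.prems])
qed simp

text \<open>Derivatives within an open set are two-sided derivatives, so smoothness is a local property. It is
used to extend a function with compact support in an open set by zero.\<close>

lemma smooth_on_open_cover:
  assumes "open S" "open T" "S \<union> T = UNIV" "smooth_on S f" "smooth_on T f"
  shows "smooth_on UNIV f"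
proof -
  have "nderiv UNIV n f differentiable (at x)" if R: "open R" "x \<in> R" "smooth_on R f" for R n x
  proof -
    have "nderiv UNIV n f differentiable_on R"
      by (rule differentiable_on_cong[OF nderiv_open[OF R(1)]]) (use R(3) in \<open>auto simp: smooth_on_def\<close>)
    then show ?thesis using R(2) at_within_open[OF R(2,1)] by (auto simp: differentiable_on_def)
  qed
  moreover have "x \<in> S \<or> x \<in> T" for x using assms(3) by blast
  ultimately show ?thesis using assms(1,2,4,5) unfolding smooth_on_def[of UNIV] differentiable_on_def
    by blast
qed

lemma smooth_on_zero:
  assumes "open S" "\<And>x. x \<in> S \<Longrightarrow> f x = 0"
  shows "smooth_on S f"
proof -
  have "tame m {()} (\<lambda>_. S) (\<lambda>_. 1) (\<lambda>_. f)" for m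
    by (rule tame_cong[OF _ tame_const[where c = "\<lambda>_. 0" and C = 1]]) (use assms in auto)
  from tame_smooth[where p = "()", OF this at_within_open_neq_bot[OF assms(1)]] show ?thesis
    by simp
qed

lemma C0inf_zero: "f \<in> C0inf B \<Longrightarrow> x \<notin> B \<Longrightarrow> f x = 0"
  using closure_subset[of "support_on UNIV f"] by (auto simp: C0inf_def support_on_def subset_iff)

lemma tame_Linf_norm:
  assumes t: "\<And>m. tame m P S (\<lambda>_. 1) f"
    and S: "\<And>p x. p \<in> P \<Longrightarrow> x \<in> S p \<Longrightarrow> at x within S p \<noteq> bot" "\<And>p. p \<in> P \<Longrightarrow> S p \<in> sets borel"
  shows "\<exists>C. \<forall>p\<in>P. Linf_norm (S p) (nderiv (S p) m (f p)) < ereal C"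
proof -
  have "unif_bdd P S (\<lambda>_. 1) (\<lambda>p. nderiv (S p) m (f p))"
    by (rule tame_nderiv_bdd[OF t S(1)])
  then obtain C where C: "\<forall>p\<in>P. \<forall>x\<in>S p. norm (nderiv (S p) m (f p) x) \<le> C * 1"
    unfolding unif_bdd_def ..
  have "Linf_norm (S p) (nderiv (S p) m (f p)) \<le> ereal C" if p: "p \<in> P" for p
    unfolding Linf_norm_def
  proof (rule esssup_I)
    have c: "continuous_on (S p) (nderiv (S p) m (f p))"
      by (rule differentiable_imp_continuous_on[OF tame_nderiv_differentiable[OF t S(1)[OF p] p]])
    have "(\<lambda>x. norm (nderiv (S p) m (f p) x)) \<in> borel_measurable (restrict_space borel (S p))"
      by (intro borel_measurable_continuous_on_restrict continuous_intros c)
    then have "(\<lambda>x. ereal (norm (nderiv (S p) m (f p) x))) \<in> borel_measurable (restrict_space borel (S p))"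
      by (rule borel_measurable_ereal)
    also have "borel_measurable (restrict_space borel (S p)) = borel_measurable (restrict_space lborel (S p))"
      by (intro measurable_cong_sets sets_restrict_space_cong) auto
    finally show "(\<lambda>x. ereal (norm (nderiv (S p) m (f p) x))) \<in> borel_measurable (restrict_space lborel (S p))" .
    show "AE x in restrict_space lborel (S p). ereal (norm (nderiv (S p) m (f p) x)) \<le> ereal C"
      by (rule AE_I2) (use C p in \<open>auto simp: space_restrict_space\<close>)
  qed
  then have "\<forall>p\<in>P. Linf_norm (S p) (nderiv (S p) m (f p)) < ereal (C + 1)"
    using le_less_trans by fastforce
  then show ?thesis by blast
qed

section \<open>Orbits of the iterated function system\<close>

context ifs
begin

abbreviation pairs :: "('n \<times> 'n) set" where "pairs \<equiv> {q. adm A (fst q) (snd q)}"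

abbreviation orbit :: "(int \<Rightarrow> 'n) \<Rightarrow> nat \<Rightarrow> real \<Rightarrow> real" where "orbit w n \<equiv> phi_iter \<phi> w 0 n"

definition dphi :: "'n \<Rightarrow> 'n \<Rightarrow> real \<Rightarrow> real" where
  "dphi i j = deriv_within (I i) (\<phi> i j)"

text \<open>By the chain rule, the derivative of \<open>orbit w n\<close>.\<close>

definition dorbit :: "(int \<Rightarrow> 'n) \<Rightarrow> nat \<Rightarrow> real \<Rightarrow> real" where
  "dorbit w n x = (\<Prod>k<n. dphi (w (int k)) (w (int k + 1)) (orbit w k x))"

text \<open>The derivative of \<open>ln \<circ> dphi i j\<close>.\<close>

definition dlog :: "'n \<Rightarrow> 'n \<Rightarrow> real \<Rightarrow> real" where
  "dlog i j x = inverse (dphi i j x) * deriv_within (I i) (dphi i j) x"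

lemma compact_I: "compact (I i)" and convex_I: "convex (I i)" and nonempty_I: "I i \<noteq> {}"
  using interval[of i] by (auto simp: convex_real_interval)

lemma perfect_I: "x \<in> I i \<Longrightarrow> at x within I i \<noteq> bot"
  using interval[of i] by (auto simp: trivial_limit_within)

lemma borel_I: "I i \<in> sets borel"
  using compact_I by (intro borel_closed compact_imp_closed)

lemma bounded_I: obtains D where "D > 0" "\<And>i x y. x \<in> I i \<Longrightarrow> y \<in> I i \<Longrightarrow> \<bar>x - y\<bar> \<le> D"
proof -
  have "bounded (\<Union>i. I i)"
    by (intro bounded_UN) (auto intro: compact_imp_bounded compact_I)
  then obtain B where B: "\<And>x i. x \<in> I i \<Longrightarrow> \<bar>x\<bar> \<le> B" unfolding bounded_iff by auto
  show thesis
  proof (rule that[of "2 * \<bar>B\<bar> + 1"])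
    fix i x y assume "x \<in> I i" "y \<in> I i"
    then show "\<bar>x - y\<bar> \<le> 2 * \<bar>B\<bar> + 1" using B[of x i] B[of y i] by linarith
  qed simp
qed

lemma phi_deriv_at: "adm A i j \<Longrightarrow> x \<in> I i \<Longrightarrow> (\<phi> i j has_vector_derivative dphi i j x) (at x within I i)"
  unfolding dphi_def by (rule deriv_within_works[OF smooth_on_differentiable[OF phi_smooth]])

lemma dphi_pos: "adm A i j \<Longrightarrow> x \<in> I i \<Longrightarrow> 0 < dphi i j x"
  and dphi_le: "adm A i j \<Longrightarrow> x \<in> I i \<Longrightarrow> dphi i j x \<le> \<theta>"
  unfolding dphi_def using phi_deriv by auto

lemma phi_in: "adm A i j \<Longrightarrow> x \<in> I i \<Longrightarrow> \<phi> i j x \<in> I j"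
  using phi_into interior_subset by blast

lemma phi_continuous: "adm A i j \<Longrightarrow> continuous_on (I i) (\<phi> i j)"
  by (rule smooth_on_continuous[OF phi_smooth])

lemma phi_contract:
  assumes "adm A i j" "x \<in> I i" "y \<in> I i"
  shows "\<bar>\<phi> i j x - \<phi> i j y\<bar> \<le> \<theta> * \<bar>x - y\<bar>"
  using field_differentiable_bound[OF convex_I
      phi_deriv_at[OF assms(1), folded has_real_derivative_iff_has_vector_derivative] _ assms(2,3), of \<theta>]
    dphi_pos[OF assms(1)] dphi_le[OF assms(1)] by (force simp: abs_le_iff)

lemma wordsD: "w \<in> words A \<Longrightarrow> adm A (w l) (w (l + 1))"
  by (simp add: words_def)

lemma words_adm_01: "w \<in> words A \<Longrightarrow> adm A (w 0) (w 1)"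
  using wordsD[of w 0] by simp

lemma shift_words: "w \<in> words A \<Longrightarrow> shift w \<in> words A"
  unfolding words_def shift_def by blast

lemma iter_in: "w \<in> words A \<Longrightarrow> x \<in> I (w i) \<Longrightarrow> phi_iter \<phi> w i n x \<in> I (w (i + int n))"
proof (induction n)
  case (Suc n)
  then show ?case
    using phi_in[OF wordsD[of w "i + int n"]] by (simp add: algebra_simps)
qed simp

lemma orbit_in: "w \<in> words A \<Longrightarrow> x \<in> I (w 0) \<Longrightarrow> orbit w n x \<in> I (w (int n))"
  using iter_in[of w x 0 n] by simp

lemma iter_contract:
  assumes "w \<in> words A" "x \<in> I (w i)" "y \<in> I (w i)"
  shows "\<bar>phi_iter \<phi> w i n x - phi_iter \<phi> w i n y\<bar> \<le> \<theta> ^ n * \<bar>x - y\<bar>"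
proof (induction n)
  case (Suc n)
  have "\<bar>phi_iter \<phi> w i (Suc n) x - phi_iter \<phi> w i (Suc n) y\<bar>
      \<le> \<theta> * \<bar>phi_iter \<phi> w i n x - phi_iter \<phi> w i n y\<bar>"
    using phi_contract[OF wordsD[OF assms(1)] iter_in[OF assms(1,2)] iter_in[OF assms(1,3)]] by simp
  also have "\<dots> \<le> \<theta> * (\<theta> ^ n * \<bar>x - y\<bar>)"
    using Suc theta by (intro mult_left_mono) auto
  finally show ?case by simp
qed simp

lemma iter_continuous: "w \<in> words A \<Longrightarrow> continuous_on (I (w i)) (phi_iter \<phi> w i n)"
proof (induction n)
  case (Suc n)
  have "phi_iter \<phi> w i n ` I (w i) \<subseteq> I (w (i + int n))" using iter_in Suc by blast
  then have "continuous_on (phi_iter \<phi> w i n ` I (w i)) (\<phi> (w (i + int n)) (w (i + int n + 1)))"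
    by (rule continuous_on_subset[OF phi_continuous[OF wordsD[OF Suc.prems]]])
  then show ?case using Suc by (simp add: continuous_on_compose del: o_apply)
qed simp

text \<open>The recursion of \<open>phi_iter\<close> appends branches at the end; shifting the word needs the first branch
instead.\<close>

lemma iter_Suc_left: "phi_iter \<phi> w i (Suc n) = phi_iter \<phi> w (i + 1) n \<circ> \<phi> (w i) (w (i + 1))"
  by (induction n) (auto simp: o_def add_ac)

lemma iter_shift: "phi_iter \<phi> (shift w) i n = phi_iter \<phi> w (i + 1) n"
  by (induction n) (auto simp: shift_def add_ac)

lemma orbit_shift: "orbit w (Suc n) x = orbit (shift w) n (\<phi> (w 0) (w 1) x)"
  using iter_Suc_left[of w 0 n] by (simp add: iter_shift del: phi_iter.simps)

subsection \<open>The point with a given past\<close>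

text \<open>Indexed by naturals and starting with the whole interval at \<open>n = 0\<close>, so that the shift of the word
becomes the step from \<open>n\<close> to \<open>Suc n\<close>.\<close>

definition cylinder :: "(int \<Rightarrow> 'n) \<Rightarrow> nat \<Rightarrow> real set" where
  "cylinder w n = phi_iter \<phi> w (- int n) n ` I (w (- int n))"

lemma cylinder_Suc:
  assumes "w \<in> words A"
  shows "cylinder w (Suc n) \<subseteq> cylinder w n"
proof
  fix y assume "y \<in> cylinder w (Suc n)"
  then obtain x where x: "x \<in> I (w (- int (Suc n)))" "y = phi_iter \<phi> w (- int (Suc n)) (Suc n) x"
    unfolding cylinder_def by blast
  have e: "- int (Suc n) + 1 = - int n" by simp
  have "\<phi> (w (- int (Suc n))) (w (- int n)) x \<in> I (w (- int n))"
    using phi_in[OF wordsD[OF assms, of "- int (Suc n)"] x(1)] e by simp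
  then show "y \<in> cylinder w n"
    unfolding cylinder_def x(2) iter_Suc_left e by auto
qed

lemma cylinder_shift: "cylinder (shift w) (Suc n) = \<phi> (w 0) (w 1) ` cylinder w n"
  unfolding cylinder_def iter_shift by (simp add: shift_def image_comp)

text \<open>The cylinders form a decreasing sequence of nonempty compact sets whose diameters are at most
\<open>\<theta>\<^sup>n\<close> times the largest length of an interval.\<close>

lemma x_pt_unique:
  assumes "w \<in> words A"
  shows "\<exists>!x. x \<in> (\<Inter>n\<in>{1::int..}. phi_word \<phi> w (- n) 0 ` I (w (- n)))"
    and "(\<Inter>n\<in>{1::int..}. phi_word \<phi> w (- n) 0 ` I (w (- n))) = (\<Inter>n. cylinder w n)"
proof -
  have anti: "m \<le> n \<Longrightarrow> cylinder w n \<subseteq> cylinder w m" for m n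
    using lift_Suc_antimono_le[of "cylinder w", OF cylinder_Suc[OF assms]] .
  have e: "phi_word \<phi> w (- int n) 0 ` I (w (- int n)) = cylinder w n" for n
    by (simp add: phi_word_def cylinder_def)
  show eq: "(\<Inter>n\<in>{1::int..}. phi_word \<phi> w (- n) 0 ` I (w (- n))) = (\<Inter>n. cylinder w n)"
  proof (rule set_eqI)
    fix x
    have "(\<forall>n::int\<ge>1. x \<in> phi_word \<phi> w (- n) 0 ` I (w (- n))) \<longleftrightarrow> (\<forall>n\<ge>1. x \<in> cylinder w n)"
    proof (intro iffI allI impI)
      fix n :: nat assume a: "\<forall>n::int\<ge>1. x \<in> phi_word \<phi> w (- n) 0 ` I (w (- n))" and n: "n \<ge> 1"
      have "1 \<le> int n" using n by simp
      with a e show "x \<in> cylinder w n" by blast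
    next
      fix n :: int assume a: "\<forall>n\<ge>1. x \<in> cylinder w n" and n: "n \<ge> 1"
      then have "x \<in> cylinder w (nat n)" by auto
      then show "x \<in> phi_word \<phi> w (- n) 0 ` I (w (- n))" using e[of "nat n"] n by simp
    qed
    also have "\<dots> \<longleftrightarrow> (\<forall>n. x \<in> cylinder w n)"
    proof (intro iffI allI impI)
      fix n assume "\<forall>n\<ge>1. x \<in> cylinder w n"
      then have "x \<in> cylinder w (Suc n)" by auto
      then show "x \<in> cylinder w n" using cylinder_Suc[OF assms] by blast
    qed auto
    finally show "x \<in> (\<Inter>n\<in>{1::int..}. phi_word \<phi> w (- n) 0 ` I (w (- n))) \<longleftrightarrow> x \<in> (\<Inter>n. cylinder w n)"
      by auto
  qed
  have "(\<Inter>n. cylinder w n) \<noteq> {}"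
  proof (rule compact_nest)
    show "compact (cylinder w n)" for n
      unfolding cylinder_def by (intro compact_continuous_image iter_continuous compact_I assms)
    show "cylinder w n \<noteq> {}" for n using nonempty_I by (simp add: cylinder_def)
  qed (rule anti)
  then obtain x where x: "x \<in> (\<Inter>n. cylinder w n)" by blast
  have "y = x" if y: "y \<in> (\<Inter>n. cylinder w n)" for y
  proof -
    obtain D where D: "D > 0" "\<And>i x y. x \<in> I i \<Longrightarrow> y \<in> I i \<Longrightarrow> \<bar>x - y\<bar> \<le> D" by (rule bounded_I, rule that)
    have "\<bar>y - x\<bar> \<le> \<theta> ^ n * D" for n
    proof -
      have "x \<in> cylinder w n" "y \<in> cylinder w n" using x y by auto
      then obtain x' y' where xy: "x' \<in> I (w (- int n))" "x = phi_iter \<phi> w (- int n) n x'"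
          "y' \<in> I (w (- int n))" "y = phi_iter \<phi> w (- int n) n y'"
        unfolding cylinder_def by blast
      have "\<bar>y - x\<bar> \<le> \<theta> ^ n * \<bar>y' - x'\<bar>" using iter_contract[OF assms xy(3,1)] xy by simp
      also have "\<dots> \<le> \<theta> ^ n * D" using D(2)[OF xy(3,1)] theta by (intro mult_left_mono) auto
      finally show ?thesis .
    qed
    moreover have "(\<lambda>n. \<theta> ^ n * D) \<longlonglongrightarrow> 0"
      using theta by (intro tendsto_mult_left_zero LIMSEQ_realpow_zero) auto
    ultimately have "\<bar>y - x\<bar> \<le> 0" by (intro LIMSEQ_le_const) auto
    then show ?thesis by simp
  qed
  then show "\<exists>!x. x \<in> (\<Inter>n\<in>{1::int..}. phi_word \<phi> w (- n) 0 ` I (w (- n)))"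
    unfolding eq by (metis x)
qed

lemma x_pt_cylinder: "w \<in> words A \<Longrightarrow> x_pt I \<phi> w \<in> cylinder w n"
  using theI'[OF x_pt_unique(1), of w, folded x_pt_def] x_pt_unique(2)[of w] by (simp only: INT_iff UNIV_I)

lemma x_pt_in: "w \<in> words A \<Longrightarrow> x_pt I \<phi> w \<in> I (w 0)"
  using x_pt_cylinder[of w 0] by (simp add: cylinder_def)

lemma x_pt_in_image: "w \<in> words A \<Longrightarrow> x_pt I \<phi> w \<in> \<phi> (w (- 1)) (w 0) ` I (w (- 1))"
  using x_pt_cylinder[of w 1] by (simp add: cylinder_def)

text \<open>The first branch maps the cylinders of \<open>w\<close> onto those of the shifted word.\<close>

lemma x_pt_shift:
  assumes "w \<in> words A"
  shows "x_pt I \<phi> (shift w) = \<phi> (w 0) (w 1) (x_pt I \<phi> w)"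
proof -
  have "\<phi> (w 0) (w 1) (x_pt I \<phi> w) \<in> cylinder (shift w) n" for n
  proof (cases n)
    case 0
    then show ?thesis using phi_in[OF words_adm_01[OF assms] x_pt_in[OF assms]] by (simp add: cylinder_def shift_def)
  next
    case (Suc m)
    then show ?thesis using x_pt_cylinder[OF assms] by (simp add: cylinder_shift)
  qed
  then show ?thesis
    using x_pt_unique[OF shift_words[OF assms]] unfolding x_pt_def
    by (intro the1_equality) auto
qed

text \<open>The base point lies in the image of the branch \<open>\<phi>\<^bsub>w\<^sub>-\<^sub>1,w\<^sub>0\<^esub>\<close>, a compact subset of the open interval
\<open>interior (I (w 0))\<close>; since there are finitely many branches, the distance to the boundary is
bounded below uniformly in \<open>w\<close>.\<close>

lemma x_pt_interior:
  obtains \<eta> where "\<eta> > 0" "\<And>w. w \<in> words A \<Longrightarrow> {x_pt I \<phi> w - \<eta>..x_pt I \<phi> w + \<eta>} \<subseteq> I (w 0)"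
proof -
  have "\<exists>e>0. \<forall>x\<in>\<phi> (fst q) (snd q) ` I (fst q). ball x e \<subseteq> I (snd q)" if q: "q \<in> pairs" for q
  proof -
    have "compact (\<phi> (fst q) (snd q) ` I (fst q))"
      using phi_continuous q by (intro compact_continuous_image compact_I) auto
    from compact_subset_open_imp_ball_epsilon_subset[OF this open_interior phi_into]
    obtain e where "e > 0" "(\<Union>x\<in>\<phi> (fst q) (snd q) ` I (fst q). ball x e) \<subseteq> interior (I (snd q))"
      using q by blast
    then show ?thesis using interior_subset by blast
  qed
  then have "\<forall>q\<in>pairs. \<exists>e>0. \<forall>x\<in>\<phi> (fst q) (snd q) ` I (fst q). ball x e \<subseteq> I (snd q)" ..
  from bchoice[OF this] obtain e
    where e': "\<forall>q\<in>pairs. e q > 0 \<and> (\<forall>x\<in>\<phi> (fst q) (snd q) ` I (fst q). ball x (e q) \<subseteq> I (snd q))" ..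
  have e: "e q > 0" "x \<in> \<phi> (fst q) (snd q) ` I (fst q) \<Longrightarrow> ball x (e q) \<subseteq> I (snd q)" if "q \<in> pairs" for q x
    using e'[rule_format, OF that] by blast+
  \<comment> \<open>Half of the radius, so that the closed interval fits into the open ball.\<close>
  define \<eta> where "\<eta> = Min (insert 1 (e ` pairs)) / 2"
  have fin: "finite (insert 1 (e ` pairs))" by simp
  show thesis
  proof (rule that)
    show \<eta>: "\<eta> > 0" unfolding \<eta>_def using e(1) fin by (simp add: Min_gr_iff)
    fix w assume w: "w \<in> words A"
    have q: "(w (-1), w 0) \<in> pairs" using wordsD[OF w, of "-1"] by simp
    then have "2 * \<eta> \<le> e (w (-1), w 0)" unfolding \<eta>_def using Min_le[OF fin] by auto
    with \<eta> have "{x_pt I \<phi> w - \<eta>..x_pt I \<phi> w + \<eta>} \<subseteq> ball (x_pt I \<phi> w) (e (w (-1), w 0))"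
      by (auto simp: dist_real_def)
    also have "ball (x_pt I \<phi> w) (e (w (-1), w 0)) \<subseteq> I (w 0)"
      using e(2)[OF q] x_pt_in_image[OF w] by simp
    finally show "{x_pt I \<phi> w - \<eta>..x_pt I \<phi> w + \<eta>} \<subseteq> I (w 0)" .
  qed
qed

section \<open>Uniform derivative bounds along orbits\<close>

lemma dorbit_Suc: "dorbit w (Suc n) x = dphi (w (int n)) (w (int n + 1)) (orbit w n x) * dorbit w n x"
  by (simp add: dorbit_def mult.commute)

lemma orbit_deriv: "fam_deriv (words A \<times> UNIV) (\<lambda>q. I (fst q 0)) (\<lambda>q. orbit (fst q) (snd q)) (\<lambda>q. dorbit (fst q) (snd q))"
proof (rule fam_derivI)
  fix q :: "(int \<Rightarrow> 'n) \<times> nat" and x assume "q \<in> words A \<times> UNIV" "x \<in> I (fst q 0)"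
  then obtain w n where q: "q = (w, n)" "w \<in> words A" "x \<in> I (w 0)" by (cases q) auto
  have "(orbit w n has_vector_derivative dorbit w n x) (at x within I (w 0))"
  proof (induction n)
    case 0
    then show ?case by (simp add: dorbit_def id_def has_vector_derivative_id)
  next
    case (Suc n)
    have "orbit w n ` I (w 0) \<subseteq> I (w (int n))" using orbit_in[OF q(2)] by blast
    note has_vector_derivative_within_subset[OF phi_deriv_at[OF wordsD[OF q(2)] orbit_in[OF q(2,3)]] this]
    with Suc have "(\<phi> (w (int n)) (w (int n + 1)) \<circ> orbit w n has_vector_derivative
        dorbit w n x *\<^sub>R dphi (w (int n)) (w (int n + 1)) (orbit w n x)) (at x within I (w 0))"
      by (rule vector_diff_chain_within)
    then show ?case by (simp only: phi_iter.simps dorbit_Suc real_scaleR_def mult.commute add_0)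
  qed
  then show "(orbit (fst q) (snd q) has_vector_derivative dorbit (fst q) (snd q) x) (at x within I (fst q 0))"
    using q by simp
qed

lemma tame_dphi: "tame m pairs (\<lambda>q. I (fst q)) (\<lambda>_. 1) (\<lambda>q. dphi (fst q) (snd q))"
  unfolding dphi_def
  by (rule smooth_tame[where X = "\<lambda>q. I (fst q)"])
     (auto intro: compact_I smooth_on_deriv phi_smooth)

lemma dphi_smooth: "adm A i j \<Longrightarrow> smooth_on (I i) (dphi i j)"
  unfolding dphi_def by (rule smooth_on_deriv[OF phi_smooth])

lemma tame_dlog: "tame m pairs (\<lambda>q. I (fst q)) (\<lambda>_. 1) (\<lambda>q. dlog (fst q) (snd q))"
proof -
  have "unif_bdd pairs (\<lambda>q. I (fst q)) (\<lambda>_. 1) (\<lambda>q x. inverse (dphi (fst q) (snd q) x))"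
  proof -
    have "compact ((\<lambda>x. inverse (dphi (fst q) (snd q) x)) ` I (fst q))" if "q \<in> pairs" for q
      using dphi_smooth[THEN smooth_on_continuous] dphi_pos that
      by (intro compact_continuous_image compact_I continuous_intros) force+
    then have "bounded (\<Union>q\<in>pairs. (\<lambda>x. inverse (dphi (fst q) (snd q) x)) ` I (fst q))"
      by (intro bounded_UN ballI compact_imp_bounded) auto
    then obtain B where "\<And>y. y \<in> (\<Union>q\<in>pairs. (\<lambda>x. inverse (dphi (fst q) (snd q) x)) ` I (fst q)) \<Longrightarrow> norm y \<le> B"
      unfolding bounded_iff by blast
    then show ?thesis by (intro unif_bddI[where C = B]) force
  qed
  then have "tame m pairs (\<lambda>q. I (fst q)) (\<lambda>_. 1) (\<lambda>q x. inverse (dphi (fst q) (snd q) x))"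
    by (intro tame_inverse[OF tame_dphi]) (use dphi_pos in force)+
  moreover have "tame m pairs (\<lambda>q. I (fst q)) (\<lambda>_. 1) (\<lambda>q. deriv_within (I (fst q)) (dphi (fst q) (snd q)))"
    by (rule smooth_tame[where X = "\<lambda>q. I (fst q)"])
       (auto intro: compact_I smooth_on_deriv dphi_smooth)
  ultimately show ?thesis unfolding dlog_def by (rule tame_mult_1)
qed

lemma dphi_deriv:
  assumes "adm A i j" "x \<in> I i"
  shows "(dphi i j has_vector_derivative dphi i j x * dlog i j x) (at x within I i)"
proof -
  have "dphi i j x * dlog i j x = deriv_within (I i) (dphi i j) x"
    using dphi_pos[OF assms] by (simp add: dlog_def)
  then show ?thesis
    using deriv_within_works[OF smooth_on_differentiable[OF dphi_smooth[OF assms(1)]] assms(2)] by simp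
qed

text \<open>Only orders below \<open>m\<close> of \<open>dorbit\<close> are assumed, so that the lemma can be used inside the induction
that proves \<open>dorbit\<close> tame.\<close>

lemma along_orbit:
  assumes "tame m pairs (\<lambda>q. I (fst q)) (\<lambda>_. 1) (\<lambda>q. g (fst q) (snd q))"
    and G: "\<And>k. k < m \<Longrightarrow> tame k (words A \<times> UNIV) (\<lambda>q. I (fst q 0)) (\<lambda>q. \<theta> ^ snd q) (\<lambda>q. dorbit (fst q) (snd q))"
  shows "tame m (words A \<times> UNIV) (\<lambda>q. I (fst q 0)) (\<lambda>_. 1)
    (\<lambda>q x. g (fst q (int (snd q))) (fst q (int (snd q) + 1)) (orbit (fst q) (snd q) x))"
proof -
  have G1: "tame k (words A \<times> UNIV) (\<lambda>q. I (fst q 0)) (\<lambda>_. 1) (\<lambda>q. dorbit (fst q) (snd q))" if "k < m" for k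
    by (rule tame_weaken[OF G[OF that]]) (use theta in \<open>auto intro: power_le_one\<close>)
  show ?thesis
    using tame_compose[OF assms(1) _ _ orbit_deriv G1,
        where \<sigma> = "\<lambda>q. (fst q (int (snd q)), fst q (int (snd q) + 1))"]
    by (auto simp: wordsD orbit_in)
qed

text \<open>The logarithmic derivative of a product of derivatives along the orbit is a sum; this turns the
growing product into a geometric sum.\<close>

lemma dorbit_deriv:
  assumes w: "w \<in> words A" and x: "x \<in> I (w 0)"
  shows "(dorbit w n has_vector_derivative
    dorbit w n x * (\<Sum>k<n. dlog (w (int k)) (w (int k + 1)) (orbit w k x) * dorbit w k x)) (at x within I (w 0))"
proof (induction n)
  case 0
  then show ?case by (simp add: dorbit_def)
next
  case (Suc n)
  let ?d = "dphi (w (int n)) (w (int n + 1))" and ?l = "dlog (w (int n)) (w (int n + 1))"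
  have "orbit w n ` I (w 0) \<subseteq> I (w (int n))" using orbit_in[OF w] by blast
  from has_vector_derivative_within_subset[OF dphi_deriv[OF wordsD[OF w] orbit_in[OF w x]] this]
  have "(?d \<circ> orbit w n has_vector_derivative dorbit w n x *\<^sub>R (?d (orbit w n x) * ?l (orbit w n x)))
      (at x within I (w 0))"
    using fam_derivD[OF orbit_deriv, of "(w, n)" x] w x by (intro vector_diff_chain_within) auto
  from has_vector_derivative_mult[OF this Suc]
  have "((\<lambda>x. (?d \<circ> orbit w n) x * dorbit w n x) has_vector_derivative
     dorbit w (Suc n) x * (\<Sum>k<Suc n. dlog (w (int k)) (w (int k + 1)) (orbit w k x) * dorbit w k x)) (at x within I (w 0))"
    by (simp add: dorbit_Suc algebra_simps)
  then show ?case unfolding o_def dorbit_Suc[symmetric] .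
qed

text \<open>All derivatives of \<open>F\<^sub>n'\<close> decay like \<open>\<theta>\<^sup>n\<close>. By \<open>dorbit_deriv\<close> the derivative of \<open>F\<^sub>n'\<close> is \<open>F\<^sub>n'\<close> times the sum over
\<open>k < n\<close> of \<open>(ln \<phi>')' (F\<^sub>k) F\<^sub>k'\<close>. At a given order the summands are of size \<open>\<theta>\<^sup>k\<close> by induction, so the sum is
bounded uniformly in \<open>n\<close> and only the factor \<open>F\<^sub>n'\<close>, which is of size \<open>\<theta>\<^sup>n\<close>, remains.\<close>

lemma tame_dorbit:
  "tame m (words A \<times> UNIV) (\<lambda>q. I (fst q 0)) (\<lambda>q. \<theta> ^ snd q) (\<lambda>q. dorbit (fst q) (snd q))"
proof (induction m rule: less_induct)
  case (less m)
  have b: "unif_bdd (words A \<times> UNIV) (\<lambda>q. I (fst q 0)) (\<lambda>q. \<theta> ^ snd q) (\<lambda>q. dorbit (fst q) (snd q))"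
  proof (rule unif_bddI[where C = 1])
    fix q :: "(int \<Rightarrow> 'n) \<times> nat" and x assume q: "q \<in> words A \<times> UNIV" "x \<in> I (fst q 0)"
    have w: "fst q \<in> words A" using q(1) by auto
    have *: "0 < dphi (fst q (int k)) (fst q (int k + 1)) (orbit (fst q) k x) \<and>
        dphi (fst q (int k)) (fst q (int k + 1)) (orbit (fst q) k x) \<le> \<theta>" for k
      using dphi_pos[OF wordsD[OF w] orbit_in[OF w q(2)]] dphi_le[OF wordsD[OF w] orbit_in[OF w q(2)]] by auto
    have "norm (dorbit (fst q) (snd q) x) = dorbit (fst q) (snd q) x"
      unfolding dorbit_def using * by (simp add: prod_nonneg less_imp_le)
    also have "\<dots> \<le> (\<Prod>k<snd q. \<theta>)"
      unfolding dorbit_def using * by (intro prod_mono) (auto simp: less_imp_le)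
    finally show "norm (dorbit (fst q) (snd q) x) \<le> 1 * \<theta> ^ snd q" by simp
  qed
  show ?case
  proof (cases m)
    case 0
    then show ?thesis using b by simp
  next
    case (Suc l)
    have IH: "tame k (words A \<times> UNIV) (\<lambda>q. I (fst q 0)) (\<lambda>q. \<theta> ^ snd q) (\<lambda>q. dorbit (fst q) (snd q))"
      if "k \<le> l" for k using less Suc that by simp
    let ?\<psi> = "\<lambda>q x. dlog (fst q (int (snd q))) (fst q (int (snd q) + 1)) (orbit (fst q) (snd q) x)
        * dorbit (fst q) (snd q) x"
    have "tame l (words A \<times> UNIV) (\<lambda>q. I (fst q 0)) (\<lambda>q. \<theta> ^ snd q) ?\<psi>"
      by (intro tame_mult_1 along_orbit tame_dlog IH) auto
    from tame_partial_sums[where S = "\<lambda>w. I (w 0)", OF this] theta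
    have "tame l (words A \<times> UNIV) (\<lambda>q. I (fst q 0)) (\<lambda>_. 1) (\<lambda>q x. \<Sum>k<snd q. ?\<psi> (fst q, k) x)"
      by simp
    from tame_mult_1[OF this IH[OF order_refl]]
    have t: "tame l (words A \<times> UNIV) (\<lambda>q. I (fst q 0)) (\<lambda>q. \<theta> ^ snd q)
        (\<lambda>q x. dorbit (fst q) (snd q) x * (\<Sum>k<snd q. dlog (fst q (int k)) (fst q (int k + 1)) (orbit (fst q) k x) * dorbit (fst q) k x))"
      by (simp add: mult.commute)
    show ?thesis unfolding Suc
      by (rule tame_SucI[OF b _ t]) (auto simp: fam_deriv_def intro!: dorbit_deriv)
  qed
qed

subsection \<open>Birkhoff sums\<close>

text \<open>Subtracting the value at the base point makes the terms decay like \<open>\<theta>\<^sup>k\<close> and normalises the sum to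
vanish at \<open>x\<^sub>w\<close>.\<close>

definition birkhoff :: "('n \<Rightarrow> 'n \<Rightarrow> real \<Rightarrow> real) \<Rightarrow> (int \<Rightarrow> 'n) \<Rightarrow> real \<Rightarrow> real" where
  "birkhoff g w x = (\<Sum>k. g (w (int k)) (w (int k + 1)) (orbit w k x)
      - g (w (int k)) (w (int k + 1)) (orbit w k (x_pt I \<phi> w)))"

lemma birkhoff_base: "birkhoff g w (x_pt I \<phi> w) = 0"
  by (simp add: birkhoff_def)

context
  fixes g g' :: "'n \<Rightarrow> 'n \<Rightarrow> real \<Rightarrow> real"
  assumes g: "fam_deriv pairs (\<lambda>q. I (fst q)) (\<lambda>q. g (fst q) (snd q)) (\<lambda>q. g' (fst q) (snd q))"
    and g': "\<And>m. tame m pairs (\<lambda>q. I (fst q)) (\<lambda>_. 1) (\<lambda>q. g' (fst q) (snd q))"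
begin

lemma birkhoff_term_deriv:
  "fam_deriv (words A \<times> UNIV) (\<lambda>q. I (fst q 0))
    (\<lambda>q x. g (fst q (int (snd q))) (fst q (int (snd q) + 1)) (orbit (fst q) (snd q) x)
      - g (fst q (int (snd q))) (fst q (int (snd q) + 1)) (orbit (fst q) (snd q) (x_pt I \<phi> (fst q))))
    (\<lambda>q x. g' (fst q (int (snd q))) (fst q (int (snd q) + 1)) (orbit (fst q) (snd q) x) * dorbit (fst q) (snd q) x)"
proof (rule fam_derivI)
  fix q :: "(int \<Rightarrow> 'n) \<times> nat" and x assume q: "q \<in> words A \<times> UNIV" "x \<in> I (fst q 0)"
  let ?i = "fst q (int (snd q))" and ?j = "fst q (int (snd q) + 1)"
  have w: "fst q \<in> words A" using q by auto
  have "orbit (fst q) (snd q) ` I (fst q 0) \<subseteq> I ?i" using orbit_in[OF w] by blast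
  moreover have "(g ?i ?j has_vector_derivative g' ?i ?j (orbit (fst q) (snd q) x))
      (at (orbit (fst q) (snd q) x) within I ?i)"
    using fam_derivD[OF g, of "(?i, ?j)"] wordsD[OF w] orbit_in[OF w q(2)] by simp
  ultimately have "(g ?i ?j has_vector_derivative g' ?i ?j (orbit (fst q) (snd q) x))
      (at (orbit (fst q) (snd q) x) within orbit (fst q) (snd q) ` I (fst q 0))"
    by (rule has_vector_derivative_within_subset[rotated])
  from vector_diff_chain_within[OF fam_derivD[OF orbit_deriv q] this]
  show "((\<lambda>x. g ?i ?j (orbit (fst q) (snd q) x) - g ?i ?j (orbit (fst q) (snd q) (x_pt I \<phi> (fst q))))
      has_vector_derivative g' ?i ?j (orbit (fst q) (snd q) x) * dorbit (fst q) (snd q) x) (at x within I (fst q 0))"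
    by (auto simp: o_def mult.commute intro!: derivative_eq_intros)
qed

lemma tame_birkhoff_term':
  "tame m (words A \<times> UNIV) (\<lambda>q. I (fst q 0)) (\<lambda>q. \<theta> ^ snd q)
    (\<lambda>q x. g' (fst q (int (snd q))) (fst q (int (snd q) + 1)) (orbit (fst q) (snd q) x) * dorbit (fst q) (snd q) x)"
  by (intro tame_mult_1 along_orbit g' tame_dorbit)

lemma tame_birkhoff_term:
  "tame m (words A \<times> UNIV) (\<lambda>q. I (fst q 0)) (\<lambda>q. \<theta> ^ snd q)
    (\<lambda>q x. g (fst q (int (snd q))) (fst q (int (snd q) + 1)) (orbit (fst q) (snd q) x)
      - g (fst q (int (snd q))) (fst q (int (snd q) + 1)) (orbit (fst q) (snd q) (x_pt I \<phi> (fst q))))"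
proof -
  obtain D where D: "D > 0" "\<And>i x y. x \<in> I i \<Longrightarrow> y \<in> I i \<Longrightarrow> \<bar>x - y\<bar> \<le> D" by (rule bounded_I, rule that)
  show ?thesis
    by (rule tame_Suc_imp, rule tame_primitive[OF tame_birkhoff_term' birkhoff_term_deriv,
          where c = "\<lambda>q. x_pt I \<phi> (fst q)" and D = D])
       (use theta in \<open>auto intro!: x_pt_in convex_I D(2)\<close>)
qed

lemma birkhoff_deriv:
  "fam_deriv (words A) (\<lambda>w. I (w 0)) (birkhoff g)
    (\<lambda>w x. \<Sum>k. g' (w (int k)) (w (int k + 1)) (orbit w k x) * dorbit w k x)"
  using geometric_series_deriv[where S = "\<lambda>w. I (w 0)",
      OF tame_bdd[OF tame_birkhoff_term[of 0]] tame_bdd[OF tame_birkhoff_term'[of 0]] birkhoff_term_deriv]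
    theta convex_I
  unfolding birkhoff_def by simp

lemma tame_birkhoff: "tame m (words A) (\<lambda>w. I (w 0)) (\<lambda>_. 1) (birkhoff g)"
  using tame_series[where S = "\<lambda>w. I (w 0)", OF tame_birkhoff_term] theta convex_I
  unfolding birkhoff_def by simp

text \<open>The cocycle identity: the tail of the series after its first term is the series of the shifted word,
whose base point is the image of \<open>x\<^sub>w\<close>.\<close>

lemma birkhoff_shift:
  assumes w: "w \<in> words A" and x: "x \<in> I (w 0)"
  shows "birkhoff g w x = g (w 0) (w 1) x - g (w 0) (w 1) (x_pt I \<phi> w)
    + birkhoff g (shift w) (\<phi> (w 0) (w 1) x)"
proof -
  let ?f = "\<lambda>k. g (w (int k)) (w (int k + 1)) (orbit w k x)
      - g (w (int k)) (w (int k + 1)) (orbit w k (x_pt I \<phi> w))"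
  obtain C where C: "C \<ge> 0" "\<And>q x. q \<in> words A \<times> UNIV \<Longrightarrow> x \<in> I (fst q 0) \<Longrightarrow>
     norm (g (fst q (int (snd q))) (fst q (int (snd q) + 1)) (orbit (fst q) (snd q) x)
      - g (fst q (int (snd q))) (fst q (int (snd q) + 1)) (orbit (fst q) (snd q) (x_pt I \<phi> (fst q)))) \<le> C * \<bar>\<theta> ^ snd q\<bar>"
    by (rule unif_bddE[OF tame_bdd[OF tame_birkhoff_term[of 0]]], rule that)
  have "summable (\<lambda>k. C * \<theta> ^ k)" using theta by (intro summable_mult summable_geometric) auto
  then have "summable ?f"
    by (rule summable_comparison_test') (use C(2)[of "(w, _)" x] w x theta in auto)
  from suminf_split_head[OF this]
  have "birkhoff g w x = ?f 0 + (\<Sum>k. ?f (Suc k))" unfolding birkhoff_def by simp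
  moreover have "?f (Suc k) = g (shift w (int k)) (shift w (int k + 1)) (orbit (shift w) k (\<phi> (w 0) (w 1) x))
      - g (shift w (int k)) (shift w (int k + 1)) (orbit (shift w) k (x_pt I \<phi> (shift w)))" for k
    unfolding orbit_shift x_pt_shift[OF w] by (simp add: shift_def add_ac)
  ultimately show ?thesis by (simp add: birkhoff_def del: phi_iter.simps) simp
qed

end

section \<open>Linearisation along words\<close>


lemma ln_dphi_deriv:
  "fam_deriv pairs (\<lambda>q. I (fst q)) (\<lambda>q x. ln (dphi (fst q) (snd q) x)) (\<lambda>q. dlog (fst q) (snd q))"
proof (rule fam_derivI)
  fix q x assume q: "q \<in> pairs" "x \<in> I (fst q)"
  then have p: "0 < dphi (fst q) (snd q) x" using dphi_pos by blast
  have "(dphi (fst q) (snd q) has_real_derivative dphi (fst q) (snd q) x * dlog (fst q) (snd q) x) (at x within I (fst q))"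
    unfolding has_real_derivative_iff_has_vector_derivative using q by (intro dphi_deriv) auto
  from DERIV_chain2[OF DERIV_ln[OF p] this]
  show "((\<lambda>x. ln (dphi (fst q) (snd q) x)) has_vector_derivative dlog (fst q) (snd q) x) (at x within I (fst q))"
    using p by (simp add: has_real_derivative_iff_has_vector_derivative mult.assoc[symmetric])
qed

definition distortion :: "(int \<Rightarrow> 'n) \<Rightarrow> real \<Rightarrow> real" where
  "distortion = birkhoff (\<lambda>i j x. ln (dphi i j x))"

lemma tame_distortion: "tame m (words A) (\<lambda>w. I (w 0)) (\<lambda>_. 1) distortion"
  unfolding distortion_def by (rule tame_birkhoff[where g' = dlog, OF ln_dphi_deriv tame_dlog])

lemma distortion_base: "distortion w (x_pt I \<phi> w) = 0"
  by (simp add: distortion_def birkhoff_base)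

text \<open>The cocycle identity for \<open>ln \<phi>'\<close>, exponentiated. It says that the two sides of \<open>lin_shift\<close> have the
same derivative.\<close>

lemma distortion_shift:
  assumes "w \<in> words A" "x \<in> I (w 0)"
  shows "dphi (w 0) (w 1) (x_pt I \<phi> w) * exp (distortion w x)
    = exp (distortion (shift w) (\<phi> (w 0) (w 1) x)) * dphi (w 0) (w 1) x"
proof -
  have "distortion w x = ln (dphi (w 0) (w 1) x) - ln (dphi (w 0) (w 1) (x_pt I \<phi> w))
      + distortion (shift w) (\<phi> (w 0) (w 1) x)"
    unfolding distortion_def by (rule birkhoff_shift[where g' = dlog, OF ln_dphi_deriv tame_dlog assms])
  moreover have "0 < dphi (w 0) (w 1) x" "0 < dphi (w 0) (w 1) (x_pt I \<phi> w)"
    using dphi_pos[OF words_adm_01] x_pt_in assms by auto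
  ultimately show ?thesis by (simp add: exp_add exp_diff)
qed

text \<open>The linearising chart \<open>h\<^sub>w\<close>, equal to \<open>lim\<^sub>n (F\<^sub>n x - F\<^sub>n x\<^sub>w) / F\<^sub>n' x\<^sub>w\<close>. Writing it as a primitive of
\<open>exp (distortion w)\<close> makes its monotonicity and its smoothness immediate.\<close>

definition lin :: "(int \<Rightarrow> 'n) \<Rightarrow> real \<Rightarrow> real" where
  "lin w = (SOME h. h (x_pt I \<phi> w) = 0 \<and>
     (\<forall>x\<in>I (w 0). (h has_vector_derivative exp (distortion w x)) (at x within I (w 0))))"

lemma lin:
  assumes w: "w \<in> words A"
  shows lin_base: "lin w (x_pt I \<phi> w) = 0"
    and lin_deriv: "x \<in> I (w 0) \<Longrightarrow> (lin w has_vector_derivative exp (distortion w x)) (at x within I (w 0))"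
proof -
  obtain a b where ab: "I (w 0) = {a..b}" using interval by blast
  have "smooth_on (I (w 0)) (distortion w)"
    using tame_smooth[OF tame_distortion perfect_I w] .
  then have "continuous_on {a..b} (\<lambda>x. exp (distortion w x))"
    using smooth_on_continuous ab by (intro continuous_intros) auto
  from antiderivative_continuous[OF this] obtain h
    where h: "\<And>x. x \<in> I (w 0) \<Longrightarrow> (h has_vector_derivative exp (distortion w x)) (at x within I (w 0))"
    unfolding ab by blast
  have "\<exists>h. h (x_pt I \<phi> w) = 0 \<and>
     (\<forall>x\<in>I (w 0). (h has_vector_derivative exp (distortion w x)) (at x within I (w 0)))"
    by (rule exI[of _ "\<lambda>x. h x - h (x_pt I \<phi> w)"])
       (use h in \<open>auto intro!: derivative_eq_intros\<close>)
  from someI_ex[OF this] show "lin w (x_pt I \<phi> w) = 0"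
    "x \<in> I (w 0) \<Longrightarrow> (lin w has_vector_derivative exp (distortion w x)) (at x within I (w 0))"
    unfolding lin_def[symmetric] by blast+
qed

lemma lin_fam_deriv: "fam_deriv (words A) (\<lambda>w. I (w 0)) lin (\<lambda>w x. exp (distortion w x))"
  by (rule fam_derivI[OF lin_deriv])

lemma tame_lin: "tame m (words A) (\<lambda>w. I (w 0)) (\<lambda>_. 1) lin"
proof -
  obtain D where D: "D > 0" "\<And>i x y. x \<in> I i \<Longrightarrow> y \<in> I i \<Longrightarrow> \<bar>x - y\<bar> \<le> D" by (rule bounded_I, rule that)
  show ?thesis
    by (rule tame_Suc_imp, rule tame_primitive[OF tame_exp[OF tame_distortion] lin_fam_deriv,
          where c = "x_pt I \<phi>" and D = D])
       (auto intro: x_pt_in convex_I D(2) lin_base)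
qed

text \<open>The distortion is bounded uniformly in \<open>w\<close>, so the derivative of the chart is bounded below.\<close>

lemma lin_expand:
  obtains c where "c > 0"
    "\<And>w x y. w \<in> words A \<Longrightarrow> x \<in> I (w 0) \<Longrightarrow> y \<in> I (w 0) \<Longrightarrow> x \<le> y \<Longrightarrow> c * (y - x) \<le> lin w y - lin w x"
proof -
  obtain C where C: "C \<ge> 0" "\<And>w x. w \<in> words A \<Longrightarrow> x \<in> I (w 0) \<Longrightarrow> norm (distortion w x) \<le> C * \<bar>1\<bar>"
    by (rule unif_bddE[OF tame_bdd[OF tame_distortion[of 0]]], rule that)
  show thesis
  proof (rule that[of "exp (- C)"])
    fix w x y assume w: "w \<in> words A" and x: "x \<in> I (w 0)" and y: "y \<in> I (w 0)" and xy: "x \<le> y"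
    show "exp (- C) * (y - x) \<le> lin w y - lin w x"
    proof (cases "x = y")
      case False
      then have "x < y" using xy by simp
      obtain a b where "I (w 0) = {a..b}" using interval by blast
      with x y have sub: "{x..y} \<subseteq> I (w 0)" by simp
      have "\<exists>z\<in>{x<..<y}. lin w y - lin w x = (\<lambda>h. h *\<^sub>R exp (distortion w z)) (y - x)"
      proof (rule mvt_simple[OF \<open>x < y\<close>])
        fix z assume z: "x \<le> z" "z \<le> y"
        then have "z \<in> I (w 0)" using sub by auto
        from has_vector_derivative_within_subset[OF lin_deriv[OF w this] sub]
        show "(lin w has_derivative (\<lambda>h. h *\<^sub>R exp (distortion w z))) (at z within {x..y})"
          by (simp add: has_vector_derivative_def)
      qed
      then obtain z where z: "z \<in> {x<..<y}" "lin w y - lin w x = (y - x) * exp (distortion w z)" by auto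
      have "z \<in> I (w 0)" using z(1) sub by auto
      then have "exp (- C) \<le> exp (distortion w z)" using C(2)[OF w, of z] by simp
      then have "exp (- C) * (y - x) \<le> exp (distortion w z) * (y - x)"
        using xy by (intro mult_right_mono) auto
      then show ?thesis using z(2) by (simp add: mult.commute)
    qed simp
  qed simp
qed

lemma lin_inj: "w \<in> words A \<Longrightarrow> inj_on (lin w) (I (w 0))"
proof (rule linorder_inj_onI)
  fix x y assume w: "w \<in> words A" and xy: "x < y" "x \<in> I (w 0)" "y \<in> I (w 0)"
  obtain c where "c > 0" "\<And>w x y. w \<in> words A \<Longrightarrow> x \<in> I (w 0) \<Longrightarrow> y \<in> I (w 0) \<Longrightarrow> x \<le> y \<Longrightarrow> c * (y - x) \<le> lin w y - lin w x"
    by (rule lin_expand, rule that)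
  from this(2)[OF w xy(2,3)] mult_pos_pos[OF this(1), of "y - x"] xy(1)
  show "lin w x \<noteq> lin w y" by auto
qed auto

lemma lin_continuous: "w \<in> words A \<Longrightarrow> continuous_on (I (w 0)) (lin w)"
  by (rule smooth_on_continuous, rule tame_smooth[OF tame_lin perfect_I])

text \<open>Both sides vanish at \<open>x\<^sub>w\<close> and have the same derivative by \<open>distortion_shift\<close>.\<close>

lemma lin_shift:
  assumes w: "w \<in> words A" and x: "x \<in> I (w 0)"
  shows "lin (shift w) (\<phi> (w 0) (w 1) x) = dphi (w 0) (w 1) (x_pt I \<phi> w) * lin w x"
proof -
  let ?p = "\<phi> (w 0) (w 1)" and ?d = "dphi (w 0) (w 1) (x_pt I \<phi> w)"
  have a: "adm A (w 0) (w 1)" using words_adm_01[OF w] .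
  have "((\<lambda>x. lin (shift w) (?p x) - ?d * lin w x) has_real_derivative 0) (at z within I (w 0))"
    if z: "z \<in> I (w 0)" for z
  proof -
    have pz: "?p z \<in> I (shift w 0)" using phi_in[OF a z] by (simp add: shift_def)
    have "?p ` I (w 0) \<subseteq> I (shift w 0)" using phi_in[OF a] by (auto simp: shift_def)
    note vector_diff_chain_within[OF phi_deriv_at[OF a z]
        has_vector_derivative_within_subset[OF lin_deriv[OF shift_words[OF w] pz] this]]
    then have "((\<lambda>x. lin (shift w) (?p x)) has_vector_derivative dphi (w 0) (w 1) z * exp (distortion (shift w) (?p z)))
        (at z within I (w 0))"
      by (simp add: o_def)
    moreover have "((\<lambda>x. ?d * lin w x) has_vector_derivative ?d * exp (distortion w z)) (at z within I (w 0))"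
      using lin_deriv[OF w z] by (auto intro!: derivative_eq_intros)
    ultimately have "((\<lambda>x. lin (shift w) (?p x) - ?d * lin w x) has_vector_derivative
        dphi (w 0) (w 1) z * exp (distortion (shift w) (?p z)) - ?d * exp (distortion w z)) (at z within I (w 0))"
      by (rule has_vector_derivative_diff)
    then show ?thesis
      using distortion_shift[OF w z] by (simp add: has_real_derivative_iff_has_vector_derivative mult.commute)
  qed
  from has_field_derivative_zero_constant[OF convex_I this]
  obtain c where c: "\<forall>z\<in>I (w 0). lin (shift w) (?p z) - ?d * lin w z = c" by blast
  from c x_pt_in[OF w] have "c = 0"
    using lin_base[OF w] lin_base[OF shift_words[OF w]] x_pt_shift[OF w] by force
  then show ?thesis using c x by auto
qed

text \<open>Within the uniform distance \<open>\<eta>\<close> of \<open>x\<^sub>w\<close> to the boundary the chart grows at rate at least \<open>c\<close> in both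
directions, so its image contains \<open>(- c \<eta>, c \<eta>)\<close>.\<close>

lemma lin_covers:
  obtains \<delta> where "\<delta> > 0"
    "\<And>w u. w \<in> words A \<Longrightarrow> \<bar>u\<bar> < \<delta> \<Longrightarrow> \<exists>z\<in>interior (I (w 0)). lin w z = u"
proof -
  obtain c where c: "c > 0" "\<And>w x y. w \<in> words A \<Longrightarrow> x \<in> I (w 0) \<Longrightarrow> y \<in> I (w 0) \<Longrightarrow> x \<le> y \<Longrightarrow> c * (y - x) \<le> lin w y - lin w x"
    by (rule lin_expand, rule that)
  obtain \<eta> where \<eta>: "\<eta> > 0" "\<And>w. w \<in> words A \<Longrightarrow> {x_pt I \<phi> w - \<eta>..x_pt I \<phi> w + \<eta>} \<subseteq> I (w 0)"
    by (rule x_pt_interior, rule that)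
  show thesis
  proof (rule that[of "c * \<eta>"])
    show "c * \<eta> > 0" using c(1) \<eta>(1) by simp
    fix w u assume w: "w \<in> words A" and u: "\<bar>u\<bar> < c * \<eta>"
    let ?x = "x_pt I \<phi> w"
    have i: "?x \<in> I (w 0)" "?x - \<eta> \<in> I (w 0)" "?x + \<eta> \<in> I (w 0)" using \<eta>(2)[OF w] \<eta>(1) by auto
    have l: "lin w (?x - \<eta>) \<le> - (c * \<eta>)" "c * \<eta> \<le> lin w (?x + \<eta>)"
      using c(2)[OF w i(2,1)] c(2)[OF w i(1,3)] \<eta>(1) lin_base[OF w] by auto
    have "\<exists>z\<ge>?x - \<eta>. z \<le> ?x + \<eta> \<and> lin w z = u"
      using l u \<eta>(1) by (intro IVT' continuous_on_subset[OF lin_continuous[OF w] \<eta>(2)[OF w]]) auto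
    then obtain z where z: "?x - \<eta> \<le> z" "z \<le> ?x + \<eta>" "lin w z = u" by blast
    have "z \<noteq> ?x - \<eta>" "z \<noteq> ?x + \<eta>" using l u z(3) by auto
    then have "z \<in> {?x - \<eta><..<?x + \<eta>}" using z by auto
    moreover have "{?x - \<eta><..<?x + \<eta>} \<subseteq> interior (I (w 0))"
      using \<eta>(2)[OF w] by (intro interior_maximal) (auto simp: subset_iff)
    ultimately show "\<exists>z\<in>interior (I (w 0)). lin w z = u" using z(3) by blast
  qed
qed

context
  fixes \<delta> :: real and J :: "real set"
  assumes \<delta>: "\<delta> > 0" and J: "J = {- \<delta><..<\<delta>}"
    and covers: "\<And>w u. w \<in> words A \<Longrightarrow> \<bar>u\<bar> < \<delta> \<Longrightarrow> \<exists>z\<in>interior (I (w 0)). lin w z = u"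
begin

text \<open>The map \<open>H\<^sub>w\<close> of the normal form.\<close>

definition lin_inv :: "(int \<Rightarrow> 'n) \<Rightarrow> real \<Rightarrow> real" where
  "lin_inv w u = inv_into (I (w 0)) (lin w) u - x_pt I \<phi> w"

lemma open_J: "open J"
  by (simp add: J)

lemma lin_inv_lin:
  assumes "w \<in> words A" "z \<in> I (w 0)"
  shows "x_pt I \<phi> w + lin_inv w (lin w z) = z"
  unfolding lin_inv_def using inv_into_f_f[OF lin_inj[OF assms(1)] assms(2)] by simp

lemma lin_lin_inv:
  assumes w: "w \<in> words A" and u: "u \<in> J"
  shows "x_pt I \<phi> w + lin_inv w u \<in> interior (I (w 0))" "lin w (x_pt I \<phi> w + lin_inv w u) = u"
proof -
  have "\<bar>u\<bar> < \<delta>" using u J by auto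
  from covers[OF w this] obtain z where z: "z \<in> interior (I (w 0))" "lin w z = u" by blast
  then have "x_pt I \<phi> w + lin_inv w u = z" using lin_inv_lin[OF w, of z] interior_subset by auto
  then show "x_pt I \<phi> w + lin_inv w u \<in> interior (I (w 0))" "lin w (x_pt I \<phi> w + lin_inv w u) = u"
    using z by auto
qed

lemma lin_inv_in: "w \<in> words A \<Longrightarrow> u \<in> J \<Longrightarrow> x_pt I \<phi> w + lin_inv w u \<in> I (w 0)"
  using lin_lin_inv(1) interior_subset by blast

lemma lin_inv_0: "w \<in> words A \<Longrightarrow> lin_inv w 0 = 0"
  using lin_inv_lin[of w "x_pt I \<phi> w"] by (simp add: lin_base x_pt_in)

lemma lin_inv_inj: "w \<in> words A \<Longrightarrow> inj_on (lin_inv w) J"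
  by (rule inj_on_inverseI[where g = "\<lambda>v. lin w (x_pt I \<phi> w + v)"]) (rule lin_lin_inv(2))

lemma lin_inv_image:
  assumes "w \<in> words A" "y \<in> I (w 0)"
  shows "y - x_pt I \<phi> w \<in> lin_inv w ` J \<longleftrightarrow> lin w y \<in> J"
proof
  assume "y - x_pt I \<phi> w \<in> lin_inv w ` J"
  then obtain u where "u \<in> J" "y = x_pt I \<phi> w + lin_inv w u" by (auto simp: algebra_simps)
  then show "lin w y \<in> J" using lin_lin_inv(2)[OF assms(1)] by simp
next
  assume "lin w y \<in> J"
  moreover have "y - x_pt I \<phi> w = lin_inv w (lin w y)" using lin_inv_lin[OF assms] by simp
  ultimately show "y - x_pt I \<phi> w \<in> lin_inv w ` J" by blast
qed

lemma inv_into_lin_inv: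
  assumes "w \<in> words A" "v \<in> lin_inv w ` J"
  shows "inv_into J (lin_inv w) v = lin w (x_pt I \<phi> w + v)"
  using assms(2) inv_into_f_f[OF lin_inv_inj[OF assms(1)]] lin_lin_inv(2)[OF assms(1)] by auto

lemma lin_inv_deriv:
  assumes w: "w \<in> words A" and u: "u \<in> J"
  shows "(lin_inv w has_real_derivative exp (- distortion w (x_pt I \<phi> w + lin_inv w u))) (at u)"
proof -
  let ?x = "x_pt I \<phi> w"
  let ?g = "\<lambda>u. ?x + lin_inv w u"
  have "continuous_on (lin w ` I (w 0)) (inv_into (I (w 0)) (lin w))"
    by (rule continuous_on_inv[OF lin_continuous[OF w] compact_I]) (simp add: inv_into_f_f[OF lin_inj[OF w]])
  moreover have "J \<subseteq> lin w ` I (w 0)"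
    using lin_lin_inv(2)[OF w] lin_inv_in[OF w] by (metis image_iff subsetI)
  ultimately have "continuous_on J ?g"
    unfolding lin_inv_def by (auto intro: continuous_on_subset)
  then have c: "isCont ?g u" using u open_J continuous_on_eq_continuous_at by blast
  have "(lin w has_vector_derivative exp (distortion w (?g u))) (at (?g u) within I (w 0))"
    by (rule lin_deriv[OF w lin_inv_in[OF w u]])
  then have d: "(lin w has_real_derivative exp (distortion w (?g u))) (at (?g u))"
    unfolding has_real_derivative_iff_has_vector_derivative at_within_interior[OF lin_lin_inv(1)[OF w u]] .
  have "(?g has_real_derivative inverse (exp (distortion w (?g u)))) (at u)"
    by (rule DERIV_inverse_function[where f = "lin w" and a = "- \<delta>" and b = \<delta>, OF d _ _ _ _ c])
       (use u lin_lin_inv(2)[OF w] J in auto)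
  then have "((\<lambda>u. ?g u - ?x) has_real_derivative inverse (exp (distortion w (?g u))) - 0) (at u)"
    by (intro DERIV_diff DERIV_const)
  then show ?thesis by (simp add: exp_minus)
qed

lemma lin_inv_fam_deriv:
  "fam_deriv (words A) (\<lambda>_. J) lin_inv (\<lambda>w u. exp (- distortion w (x_pt I \<phi> w + lin_inv w u)))"
  "fam_deriv (words A) (\<lambda>_. J) (\<lambda>w u. x_pt I \<phi> w + lin_inv w u) (\<lambda>w u. exp (- distortion w (x_pt I \<phi> w + lin_inv w u)))"
  unfolding fam_deriv_def has_real_derivative_iff_has_vector_derivative[symmetric]
  using lin_inv_deriv by (auto intro!: derivative_eq_intros intro: has_field_derivative_at_within)

text \<open>Bootstrap: \<open>H\<^sub>w' = exp (- distortion w (x\<^sub>w + H\<^sub>w))\<close>, so a bound on \<open>H\<^sub>w'\<close> below order \<open>m\<close> gives one at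
order \<open>m\<close> through \<open>tame_compose\<close>.\<close>

lemma tame_lin_inv': "tame m (words A) (\<lambda>_. J) (\<lambda>_. 1) (\<lambda>w u. exp (- distortion w (x_pt I \<phi> w + lin_inv w u)))"
proof (induction m rule: less_induct)
  case (less m)
  have "tame m (words A) (\<lambda>w. I (w 0)) (\<lambda>_. 1) (\<lambda>w x. exp (- 1 * distortion w x))"
    by (intro tame_exp tame_cmult tame_distortion)
  from tame_compose[OF this _ _ lin_inv_fam_deriv(2) less, where \<sigma> = "\<lambda>w. w"]
  show ?case using lin_inv_in by simp
qed

lemma tame_lin_inv: "tame m (words A) (\<lambda>_. J) (\<lambda>_. 1) lin_inv"
  by (rule tame_Suc_imp, rule tame_primitive[OF tame_lin_inv' lin_inv_fam_deriv(1), where c = "\<lambda>_. 0" and D = \<delta>])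
     (use \<delta> in \<open>auto simp: lin_inv_0 J\<close>)

lemma open_lin_inv_image:
  assumes w: "w \<in> words A"
  shows "open (lin_inv w ` J)"
proof (rule invariance_of_domain[OF _ open_J lin_inv_inj[OF w]])
  show "continuous_on J (lin_inv w)"
    using lin_inv_deriv[OF w] by (auto intro!: continuous_at_imp_continuous_on DERIV_isCont)
qed

lemma tame_inv_lin_inv: "tame m (words A) (\<lambda>w. lin_inv w ` J) (\<lambda>_. 1) (\<lambda>w. inv_into J (lin_inv w))"
proof -
  have d: "fam_deriv (words A) (\<lambda>w. lin_inv w ` J) (\<lambda>w v. x_pt I \<phi> w + v) (\<lambda>w v. 1)"
    unfolding fam_deriv_def by (auto intro!: derivative_eq_intros)
  have "tame m (words A) (\<lambda>w. lin_inv w ` J) (\<lambda>_. 1) (\<lambda>w v. lin w (x_pt I \<phi> w + v))"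
    by (rule tame_compose[OF tame_lin _ _ d tame_const[where C = 1], where \<sigma> = "\<lambda>w. w"])
       (auto intro: lin_inv_in)
  then show ?thesis
    by (rule tame_cong[rotated]) (simp add: inv_into_lin_inv)
qed

lemma perfect_J: "u \<in> J \<Longrightarrow> at u within J \<noteq> bot"
  by (rule at_within_open_neq_bot[OF open_J])

lemma perfect_lin_inv_image: "w \<in> words A \<Longrightarrow> v \<in> lin_inv w ` J \<Longrightarrow> at v within (lin_inv w ` J) \<noteq> bot"
  by (rule at_within_open_neq_bot[OF open_lin_inv_image])

lemma lin_inv_diffeo:
  assumes w: "w \<in> words A"
  shows "diffeo_onto_image J (lin_inv w)"
  unfolding diffeo_onto_image_def
  using tame_smooth[OF tame_lin_inv perfect_J w] lin_inv_inj[OF w]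
    tame_smooth[OF tame_inv_lin_inv perfect_lin_inv_image[OF w] w] by blast

text \<open>The points that the chart sends into \<open>J\<close>; this is the neighbourhood of \<open>x\<^sub>w\<close> on which the transfer
operator is put into normal form.\<close>

abbreviation chart :: "(int \<Rightarrow> 'n) \<Rightarrow> real set" where
  "chart w \<equiv> {y \<in> I (w 0). lin w y \<in> J}"

lemma chart_eq:
  assumes w: "w \<in> words A"
  shows "chart w = (\<lambda>v. x_pt I \<phi> w + v) ` lin_inv w ` J"
proof (intro set_eqI iffI)
  fix y assume "y \<in> chart w"
  then have "y = x_pt I \<phi> w + lin_inv w (lin w y)" "lin w y \<in> J" using lin_inv_lin[OF w, of y] by auto
  then show "y \<in> (\<lambda>v. x_pt I \<phi> w + v) ` lin_inv w ` J" by blast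
next
  fix y assume "y \<in> (\<lambda>v. x_pt I \<phi> w + v) ` lin_inv w ` J"
  then show "y \<in> chart w" using lin_inv_in[OF w] lin_lin_inv(2)[OF w] by auto
qed

lemma open_chart: "w \<in> words A \<Longrightarrow> open (chart w)"
  using open_translation[OF open_lin_inv_image] by (simp only: chart_eq)

section \<open>The conjugation\<close>

context
  fixes \<Upsilon> :: "(int \<Rightarrow> 'n) \<Rightarrow> real \<Rightarrow> complex" and \<nu> :: real
  assumes \<Upsilon>: "\<And>m. tame m (words A) (\<lambda>w. I (w 0)) (\<lambda>_. 1) \<Upsilon>"
begin

abbreviation nf :: "(int \<Rightarrow> 'n) \<Rightarrow> (real \<Rightarrow> complex) \<Rightarrow> real \<Rightarrow> complex" where
  "nf w \<equiv> normal_op \<nu> (I (w 0)) (\<Upsilon> w) (x_pt I \<phi> w) J (lin_inv w)"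

definition nf_inv :: "(int \<Rightarrow> 'n) \<Rightarrow> (real \<Rightarrow> complex) \<Rightarrow> real \<Rightarrow> complex" where
  "nf_inv w f u = (if u \<in> J then exp (- (\<i> * of_real \<nu> * \<Upsilon> w (x_pt I \<phi> w + lin_inv w u))) * f (x_pt I \<phi> w + lin_inv w u) else 0)"

text \<open>This replaces \<open>inv_into J (lin_inv w)\<close> in the operator by the chart, which is defined on all of \<open>I (w 0)\<close>.\<close>

lemma nf_apply:
  assumes w: "w \<in> words A"
  shows "nf w g y = (if y \<in> chart w then exp (\<i> * of_real \<nu> * \<Upsilon> w y) * g (lin w y) else 0)"
  using lin_inv_image[OF w] inv_into_lin_inv[OF w, of "y - x_pt I \<phi> w"]
  by (auto simp: normal_op_def mult_op_def trans_op_def comp_op_def)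

lemma nf_inj:
  assumes w: "w \<in> words A"
  shows "inj_on (nf w) (C0inf J)"
proof (rule inj_onI, rule ext)
  fix f g u assume fg: "f \<in> C0inf J" "g \<in> C0inf J" "nf w f = nf w g"
  show "f u = g u"
  proof (cases "u \<in> J")
    case True
    then have "nf w f (x_pt I \<phi> w + lin_inv w u) = nf w g (x_pt I \<phi> w + lin_inv w u)"
      using fg by simp
    then show ?thesis unfolding nf_apply[OF w] using True lin_inv_in[OF w] lin_lin_inv(2)[OF w] by simp
  qed (simp add: C0inf_zero[OF fg(1)] C0inf_zero[OF fg(2)])
qed

lemma nf_nf_inv:
  assumes w: "w \<in> words A" and f: "f \<in> C0inf (chart w)"
  shows "nf w (nf_inv w f) = f"
proof
  fix y
  show "nf w (nf_inv w f) y = f y"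
  proof (cases "y \<in> chart w")
    case True
    then show ?thesis
      unfolding nf_apply[OF w] nf_inv_def by (simp add: lin_inv_lin[OF w] exp_minus)
  next
    case False
    then show ?thesis using C0inf_zero[OF f] unfolding nf_apply[OF w] by auto
  qed
qed

text \<open>The closed support of \<open>f\<close> is a compact part of the chart domain, so its image under the chart is
compact in \<open>J\<close>. Outside this image \<open>nf_inv w f\<close> vanishes, which makes the extension by zero smooth.\<close>

lemma nf_inv_C0inf:
  assumes w: "w \<in> words A" and f: "f \<in> C0inf (chart w)"
  shows "nf_inv w f \<in> C0inf J"
proof -
  let ?K = "closure (support_on UNIV f)"
  have fs: "smooth_on UNIV f" and K: "?K \<subseteq> chart w" using f by (auto simp: C0inf_def)
  have KI: "?K \<subseteq> I (w 0)" using K by blast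
  then have Kc: "compact ?K"
    using bounded_subset[OF compact_imp_bounded[OF compact_I]] by (simp add: compact_eq_bounded_closed)
  have K'c: "compact (lin w ` ?K)"
    by (rule compact_continuous_image[OF continuous_on_subset[OF lin_continuous[OF w] KI] Kc])
  have K'J: "lin w ` ?K \<subseteq> J" using K by auto
  have z: "nf_inv w f u = 0" if "u \<notin> lin w ` ?K" for u
  proof (cases "u \<in> J")
    case True
    have "x_pt I \<phi> w + lin_inv w u \<notin> ?K"
      using that lin_lin_inv(2)[OF w True] by (metis image_eqI)
    then have "x_pt I \<phi> w + lin_inv w u \<notin> support_on UNIV f" using closure_subset by blast
    then show ?thesis by (simp add: nf_inv_def support_on_def)
  qed (simp add: nf_inv_def)
  have "support_on UNIV (nf_inv w f) \<subseteq> lin w ` ?K" using z by (auto simp: support_on_def)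
  then have "closure (support_on UNIV (nf_inv w f)) \<subseteq> lin w ` ?K"
    by (rule closure_minimal) (rule compact_imp_closed[OF K'c])
  then have "closure (support_on UNIV (nf_inv w f)) \<subseteq> J" using K'J by blast
  moreover have "smooth_on UNIV (nf_inv w f)"
  proof (rule smooth_on_open_cover[OF open_J, where T = "- (lin w ` ?K)"])
    show o: "open (- (lin w ` ?K))" using compact_imp_closed[OF K'c] by (rule open_Compl)
    show "J \<union> - (lin w ` ?K) = UNIV" using K'J by blast
    show "smooth_on (- (lin w ` ?K)) (nf_inv w f)" by (rule smooth_on_zero[OF o]) (use z in simp)
    have "tame m {w} (\<lambda>_. J) (\<lambda>_. 1) (\<lambda>w u. exp ((- (\<i> * of_real \<nu>)) * \<Upsilon> w (x_pt I \<phi> w + lin_inv w u)) * f (x_pt I \<phi> w + lin_inv w u))" for m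
    proof (rule tame_mult_1[OF tame_exp[OF tame_cmult]])
      have d: "fam_deriv {w} (\<lambda>_. J) (\<lambda>w u. x_pt I \<phi> w + lin_inv w u) (\<lambda>w u. exp (- distortion w (x_pt I \<phi> w + lin_inv w u)))"
        using lin_inv_fam_deriv(2) w unfolding fam_deriv_def by blast
      have t: "tame k {w} (\<lambda>_. J) (\<lambda>_. 1) (\<lambda>w u. exp (- distortion w (x_pt I \<phi> w + lin_inv w u)))" for k
        by (rule tame_subset[OF tame_lin_inv']) (use w in auto)
      show "tame m {w} (\<lambda>_. J) (\<lambda>_. 1) (\<lambda>w u. \<Upsilon> w (x_pt I \<phi> w + lin_inv w u))"
        by (rule tame_compose[OF \<Upsilon> _ _ d t, where \<sigma> = "\<lambda>w. w"]) (use w lin_inv_in in auto)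
      have "tame m {w} (\<lambda>w. I (w 0)) (\<lambda>_. 1) (\<lambda>_. f)"
        by (rule smooth_tame[where X = "\<lambda>_. UNIV"]) (auto intro: compact_I fs)
      from tame_compose[OF this _ _ d t, where \<sigma> = "\<lambda>w. w"]
      show "tame m {w} (\<lambda>_. J) (\<lambda>_. 1) (\<lambda>w u. f (x_pt I \<phi> w + lin_inv w u))"
        using w lin_inv_in by simp
    qed
    from tame_smooth[OF this perfect_J]
    have "smooth_on J (\<lambda>u. exp ((- (\<i> * of_real \<nu>)) * \<Upsilon> w (x_pt I \<phi> w + lin_inv w u)) * f (x_pt I \<phi> w + lin_inv w u))"
      by simp
    then show "smooth_on J (nf_inv w f)"
      by (rule smooth_on_cong[rotated]) (simp add: nf_inv_def)
  qed
  ultimately show ?thesis by (simp add: C0inf_def)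
qed

text \<open>Writing \<open>y = \<phi> z\<close>, the dilation turns \<open>lin (shift w) y\<close> into \<open>lin w z\<close>, so that the right-hand side evaluates
\<open>f\<close> at \<open>z\<close> as the transfer operator does, and the weights agree by the cocycle hypothesis. If \<open>y\<close> is
not in the image of the branch both sides vanish: a nonzero value on the right would provide a point
\<open>z\<close> with \<open>lin (shift w) (\<phi> z) = lin (shift w) y\<close>, and the chart is injective.\<close>

lemma conjugation:
  assumes w: "w \<in> words A"
    and coc: "\<And>z. z \<in> I (w 0) \<Longrightarrow>
      c * (exp (\<i> * of_real \<nu> * \<Upsilon> (shift w) (\<phi> (w 0) (w 1) z)) * exp (- (\<i> * of_real \<nu> * \<Upsilon> w z)))
        = exp (\<i> * of_real (\<nu> * \<tau> (\<phi> (w 0) (w 1) z)) + of_real (V (\<phi> (w 0) (w 1) z)))"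
  shows "conjugates_on (chart w) J (transfer_op I \<phi> \<tau> V \<nu> (w 0) (w 1)) c (nf (shift w))
    (jac I \<phi> (w 0) (w 1) (x_pt I \<phi> w)) (nf w)"
  unfolding conjugates_on_def
proof (intro conjI ballI)
  show "inj_on (nf w) (C0inf J)" by (rule nf_inj[OF w])
  show "C0inf (chart w) \<subseteq> nf w ` C0inf J"
  proof
    fix f assume "f \<in> C0inf (chart w)"
    then show "f \<in> nf w ` C0inf J"
      using nf_nf_inv[OF w] nf_inv_C0inf[OF w] by (intro image_eqI[where x = "nf_inv w f"]) auto
  qed
  fix f assume f: "f \<in> C0inf (chart w)"
  let ?p = "\<phi> (w 0) (w 1)" and ?d = "dphi (w 0) (w 1) (x_pt I \<phi> w)"
  let ?s = "jac I \<phi> (w 0) (w 1) (x_pt I \<phi> w)"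
  have a: "adm A (w 0) (w 1)" using words_adm_01[OF w] .
  have d: "0 < ?d" "?d < 1"
    using dphi_pos[OF a x_pt_in[OF w]] dphi_le[OF a x_pt_in[OF w]] theta by auto
  have s: "exp ?s = inverse ?d"
    using d by (simp add: jac_def dphi_def exp_minus)
  have inv: "inv_into (C0inf J) (nf w) f = nf_inv w f"
    using inv_into_f_f[OF nf_inj[OF w] nf_inv_C0inf[OF w f]] by (simp only: nf_nf_inv[OF w f])
  have w': "shift w \<in> words A" using shift_words[OF w] .
  have w'0: "shift w 0 = w 1" by (simp add: shift_def)
  show "transfer_op I \<phi> \<tau> V \<nu> (w 0) (w 1) f
      = (\<lambda>y. c * (nf (shift w) \<circ> dil_op ?s \<circ> inv_into (C0inf J) (nf w)) f y)"
  proof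
    fix y
    have R: "(nf (shift w) \<circ> dil_op ?s \<circ> inv_into (C0inf J) (nf w)) f y =
        (if y \<in> chart (shift w) then exp (\<i> * of_real \<nu> * \<Upsilon> (shift w) y) * nf_inv w f (inverse ?d * lin (shift w) y) else 0)"
      by (simp add: inv nf_apply[OF w'] dil_op_def s)
    show "transfer_op I \<phi> \<tau> V \<nu> (w 0) (w 1) f y
        = c * (nf (shift w) \<circ> dil_op ?s \<circ> inv_into (C0inf J) (nf w)) f y"
    proof (cases "y \<in> ?p ` I (w 0)")
      case True
      then obtain z where z: "z \<in> I (w 0)" "y = ?p z" by blast
      have L: "transfer_op I \<phi> \<tau> V \<nu> (w 0) (w 1) f y
          = exp (\<i> * of_real (\<nu> * \<tau> (?p z)) + of_real (V (?p z))) * f z"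
        unfolding transfer_op_def z(2) using z(1) inv_into_f_f[OF phi_inj[OF a] z(1)] by simp
      have l: "lin (shift w) y = ?d * lin w z" using lin_shift[OF w z(1)] z(2) by simp
      have c1: "inverse ?d * (?d * lin w z) = lin w z" using d by (simp add: mult.assoc[symmetric])
      have y: "y \<in> I (shift w 0)" using phi_in[OF a z(1)] z(2) w'0 by simp
      show ?thesis
      proof (cases "lin w z \<in> J")
        case True
        \<comment> \<open>The branch contracts in the charts, so it maps \<open>chart w\<close> into \<open>chart (shift w)\<close>.\<close>
        have "\<bar>?d * lin w z\<bar> \<le> \<bar>lin w z\<bar>"
          using d by (simp add: abs_mult mult_left_le_one_le)
        also have "\<dots> < \<delta>" using True J by auto
        finally have "y \<in> chart (shift w)" using y l J by auto
        then show ?thesis unfolding R L coc[OF z(1), symmetric]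
          using l True by (simp add: nf_inv_def lin_inv_lin[OF w z(1)] z(2) c1)
      next
        case False
        \<comment> \<open>\<open>y\<close> may still lie in \<open>chart (shift w)\<close>, but the dilated argument has left \<open>J\<close>.\<close>
        then have "f z = 0" using C0inf_zero[OF f] by simp
        then show ?thesis unfolding R L using l False by (simp add: nf_inv_def c1)
      qed
    next
      case False
      have "nf_inv w f (inverse ?d * lin (shift w) y) = 0" if y: "y \<in> chart (shift w)"
      proof (rule ccontr)
        assume "nf_inv w f (inverse ?d * lin (shift w) y) \<noteq> 0"
        then have u: "inverse ?d * lin (shift w) y \<in> J" by (auto simp: nf_inv_def split: if_splits)
        define z where "z = x_pt I \<phi> w + lin_inv w (inverse ?d * lin (shift w) y)"
        have z: "z \<in> I (w 0)" "lin w z = inverse ?d * lin (shift w) y"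
          unfolding z_def using lin_inv_in[OF w u] lin_lin_inv(2)[OF w u] by auto
        have "lin (shift w) (?p z) = lin (shift w) y" using lin_shift[OF w z(1)] z(2) d by simp
        moreover have "?p z \<in> I (shift w 0)" using phi_in[OF a z(1)] w'0 by simp
        ultimately have "?p z = y" using inj_onD[OF lin_inj[OF w']] y by blast
        then show False using False z(1) by blast
      qed
      then show ?thesis unfolding R using False by (simp add: transfer_op_def)
    qed
  qed
qed

end

end

section \<open>The global normal form\<close>


lemma compact_ifs_image: "compact (ifs_image A I \<phi>)"
  unfolding ifs_image_def
  by (intro compact_UN) (auto intro!: compact_continuous_image phi_continuous compact_I)

lemma phi_in_ifs_image: "adm A i j \<Longrightarrow> x \<in> I i \<Longrightarrow> \<phi> i j x \<in> ifs_image A I \<phi>"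
  unfolding ifs_image_def by blast

context
  fixes \<tau> :: "real \<Rightarrow> real"
  assumes \<tau>: "smooth_on (ifs_image A I \<phi>) \<tau>"
begin

text \<open>The weights are only defined on the image of the system, so the Birkhoff sums are formed with
\<open>\<tau> \<circ> \<phi>\<^bsub>i,j\<^esub>\<close> on \<open>I i\<close>. In this way the sum starts with the value at the first image, as \<open>\<zeta>\<^sub>w\<close> does.\<close>

lemma pullback_deriv:
  "fam_deriv pairs (\<lambda>q. I (fst q)) (\<lambda>q x. \<tau> (\<phi> (fst q) (snd q) x))
    (\<lambda>q x. dphi (fst q) (snd q) x * deriv_within (ifs_image A I \<phi>) \<tau> (\<phi> (fst q) (snd q) x))"
proof (rule fam_derivI)
  fix q x assume "q \<in> pairs" "x \<in> I (fst q)"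
  then have q: "adm A (fst q) (snd q)" "x \<in> I (fst q)" by auto
  have "\<phi> (fst q) (snd q) ` I (fst q) \<subseteq> ifs_image A I \<phi>" using phi_in_ifs_image[OF q(1)] by blast
  from has_vector_derivative_within_subset[OF
      deriv_within_works[OF smooth_on_differentiable[OF \<tau>] phi_in_ifs_image[OF q]] this]
  have "(\<tau> has_vector_derivative deriv_within (ifs_image A I \<phi>) \<tau> (\<phi> (fst q) (snd q) x))
      (at (\<phi> (fst q) (snd q) x) within \<phi> (fst q) (snd q) ` I (fst q))" .
  from vector_diff_chain_within[OF phi_deriv_at[OF q] this]
  show "((\<lambda>x. \<tau> (\<phi> (fst q) (snd q) x)) has_vector_derivative
      dphi (fst q) (snd q) x * deriv_within (ifs_image A I \<phi>) \<tau> (\<phi> (fst q) (snd q) x)) (at x within I (fst q))"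
    by (simp add: o_def)
qed

lemma tame_pullback_deriv:
  "tame m pairs (\<lambda>q. I (fst q)) (\<lambda>_. 1)
    (\<lambda>q x. dphi (fst q) (snd q) x * deriv_within (ifs_image A I \<phi>) \<tau> (\<phi> (fst q) (snd q) x))"
proof (rule tame_mult_1[OF tame_dphi])
  have t: "tame m {()} (\<lambda>_. ifs_image A I \<phi>) (\<lambda>_. 1) (\<lambda>_. deriv_within (ifs_image A I \<phi>) \<tau>)"
    by (rule smooth_tame[where X = "\<lambda>_. ifs_image A I \<phi>"])
       (auto intro: compact_ifs_image smooth_on_deriv \<tau>)
  have d: "fam_deriv pairs (\<lambda>q. I (fst q)) (\<lambda>q. \<phi> (fst q) (snd q)) (\<lambda>q. dphi (fst q) (snd q))"
    by (rule fam_derivI[OF phi_deriv_at]) auto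
  show "tame m pairs (\<lambda>q. I (fst q)) (\<lambda>_. 1) (\<lambda>q x. deriv_within (ifs_image A I \<phi>) \<tau> (\<phi> (fst q) (snd q) x))"
    by (rule tame_compose[OF t _ _ d tame_dphi, where \<sigma> = "\<lambda>_. ()"])
       (auto intro: phi_in_ifs_image)
qed

abbreviation future_sum :: "(int \<Rightarrow> 'n) \<Rightarrow> real \<Rightarrow> real" where
  "future_sum \<equiv> birkhoff (\<lambda>i j x. \<tau> (\<phi> i j x))"

lemma tame_future_sum: "tame m (words A) (\<lambda>w. I (w 0)) (\<lambda>_. 1) future_sum"
  by (rule tame_birkhoff[OF pullback_deriv tame_pullback_deriv])

lemma future_sum_shift:
  assumes "w \<in> words A" "x \<in> I (w 0)"
  shows "future_sum w x = \<tau> (\<phi> (w 0) (w 1) x) - \<tau> (x_pt I \<phi> (shift w))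
    + future_sum (shift w) (\<phi> (w 0) (w 1) x)"
  using birkhoff_shift[OF pullback_deriv tame_pullback_deriv assms] x_pt_shift[OF assms(1)] by simp

text \<open>The terms agree because \<open>dorbit w (Suc m) = \<phi>' (F\<^sub>m) dorbit w m\<close>.\<close>

lemma future_sum_zeta:
  assumes w: "w \<in> words A" and y: "y \<in> I (w 0)"
  shows "deriv_within (I (w 0)) (\<lambda>x. - future_sum w x) y = zeta_fn A I \<phi> \<tau> w y"
proof (rule deriv_within_eq[OF perfect_I[OF y]])
  let ?X = "ifs_image A I \<phi>"
  let ?g' = "\<lambda>k. dphi (w (int k)) (w (int k + 1)) (orbit w k y) *
      deriv_within ?X \<tau> (\<phi> (w (int k)) (w (int k + 1)) (orbit w k y)) * dorbit w k y"
  have t: "(let k = int (Suc m) in deriv_within (I (w 0)) (phi_word \<phi> w 0 k) y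
      * deriv_within ?X \<tau> (phi_word \<phi> w 0 k y)) = ?g' m" for m
  proof -
    have pw: "phi_word \<phi> w 0 (int (Suc m)) = orbit w (Suc m)"
      unfolding phi_word_def diff_0_right nat_int ..
    have "(orbit w (Suc m) has_vector_derivative dorbit w (Suc m) y) (at y within I (w 0))"
      using fam_derivD[OF orbit_deriv, of "(w, Suc m)" y] w y by (simp del: phi_iter.simps)
    from deriv_within_eq[OF perfect_I[OF y] this]
    show ?thesis unfolding Let_def pw dorbit_Suc by (simp add: mult_ac)
  qed
  have "(future_sum w has_vector_derivative (\<Sum>k. ?g' k)) (at y within I (w 0))"
    using fam_derivD[OF birkhoff_deriv[OF pullback_deriv tame_pullback_deriv], of w y] w y by simp
  from has_vector_derivative_minus[OF this]
  show "((\<lambda>x. - future_sum w x) has_vector_derivative zeta_fn A I \<phi> \<tau> w y) (at y within I (w 0))"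
    unfolding zeta_fn_def t .
qed

end

end

theorem theorem5p2:
  fixes A :: "real^'n^'n"
    and I :: "'n::finite \<Rightarrow> real set"
    and \<phi> :: "'n \<Rightarrow> 'n \<Rightarrow> real \<Rightarrow> real"
    and \<theta> :: real
    and \<tau> V :: "real \<Rightarrow> real"
  assumes "ifs A I \<phi> \<theta>"
    and "smooth_on (ifs_image A I \<phi>) \<tau>"
    and "smooth_on (ifs_image A I \<phi>) V"
  shows "\<exists>J :: real set. open J \<and> 0 \<in> J \<and>
    (\<exists>H \<Upsilon>0 \<Upsilon>1 :: (int \<Rightarrow> 'n) \<Rightarrow> real \<Rightarrow> real.
      (\<forall>w\<in>words A.
         smooth_on (I (w 0)) (\<Upsilon>0 w) \<and> smooth_on (I (w 0)) (\<Upsilon>1 w) \<and>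
         diffeo_onto_image J (H w) \<and>
         (\<lambda>y. x_pt I \<phi> w + H w y) ` J \<subseteq> I (w 0)) \<and>
      (\<forall>\<nu>>0.
         let \<Upsilon> = (\<lambda>w. symbol \<nu> (\<Upsilon>0 w) (\<Upsilon>1 w));
             T = (\<lambda>w. normal_op \<nu> (I (w 0)) (\<Upsilon> w) (x_pt I \<phi> w) J (H w))
         in
         (\<forall>w\<in>words A.
            (\<exists>U. open U \<and> x_pt I \<phi> w \<in> U \<and> U \<subseteq> I (w 0) \<and>
               conjugates_on U J
                 (transfer_op I \<phi> \<tau> V \<nu> (w 0) (w 1))
                 (exp (\<i> * of_real (\<nu> * \<tau> (x_pt I \<phi> (shift w))) + of_real (V (x_pt I \<phi> (shift w)))))
                 (T (shift w))
                 (jac I \<phi> (w 0) (w 1) (x_pt I \<phi> w))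
                 (T w)) \<and>
            normal_map (I (w 0)) (\<Upsilon>0 w) (x_pt I \<phi> w) J (H w) (0, 0)
              = (x_pt I \<phi> w, xi_pt A I \<phi> \<tau> w) \<and>
            H w 0 = 0 \<and> deriv_within J (H w) 0 = 1 \<and>
            \<Upsilon> w (x_pt I \<phi> w) = 0 \<and>
            (\<forall>y\<in>I (w 0). deriv_within (I (w 0)) (\<Upsilon>0 w) y = zeta_fn A I \<phi> \<tau> w y)) \<and>
         (\<forall>\<alpha>. \<exists>C::real. \<forall>w\<in>words A.
            Linf_norm J (nderiv J \<alpha> (H w)) < ereal C \<and>
            Linf_norm (H w ` J) (nderiv (H w ` J) \<alpha> (inv_into J (H w))) < ereal C \<and>
            Linf_norm (I (w 0)) (nderiv (I (w 0)) \<alpha> (\<Upsilon> w)) < ereal C)))"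
proof -
  interpret ifs A I \<phi> \<theta> by (rule assms(1))
  note \<tau> = assms(2) and V = assms(3)
  obtain \<delta> where \<delta>: "\<delta> > 0"
    and covers: "\<And>w u. w \<in> words A \<Longrightarrow> \<bar>u\<bar> < \<delta> \<Longrightarrow> \<exists>z\<in>interior (I (w 0)). lin w z = u"
    by (rule lin_covers, rule that)
  define J where J: "J = {- \<delta><..<\<delta>}"
  note ctxt = \<delta> J covers
  define \<Upsilon>0 where "\<Upsilon>0 w x = - birkhoff (\<lambda>i j x. \<tau> (\<phi> i j x)) w x" for w x
  define \<Upsilon>1 where "\<Upsilon>1 = birkhoff (\<lambda>i j x. V (\<phi> i j x))"
  define \<Upsilon> where "\<Upsilon> \<nu> w = symbol \<nu> (\<Upsilon>0 w) (\<Upsilon>1 w)" for \<nu> w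
  have t0: "tame m (words A) (\<lambda>w. I (w 0)) (\<lambda>_. 1) \<Upsilon>0" for m
    using tame_cmult[OF tame_future_sum[OF \<tau>], of m "- 1"] unfolding \<Upsilon>0_def[abs_def] by simp
  have t1: "tame m (words A) (\<lambda>w. I (w 0)) (\<lambda>_. 1) \<Upsilon>1" for m
    unfolding \<Upsilon>1_def by (rule tame_future_sum[OF V])
  have t: "tame m (words A) (\<lambda>w. I (w 0)) (\<lambda>_. 1) (\<Upsilon> \<nu>)" for m \<nu>
    unfolding \<Upsilon>_def[abs_def] symbol_def
    by (intro tame_add tame_cmult tame_of_real t0 t1)
  have base: "\<Upsilon> \<nu> w (x_pt I \<phi> w) = 0" for \<nu> w
    by (simp add: \<Upsilon>_def symbol_def \<Upsilon>0_def \<Upsilon>1_def birkhoff_base)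
  have zeta: "deriv_within (I (w 0)) (\<Upsilon>0 w) y = zeta_fn A I \<phi> \<tau> w y" if "w \<in> words A" "y \<in> I (w 0)" for w y
    using future_sum_zeta[OF \<tau> that] unfolding \<Upsilon>0_def[abs_def] .
  have conj: "\<exists>U. open U \<and> x_pt I \<phi> w \<in> U \<and> U \<subseteq> I (w 0) \<and>
               conjugates_on U J
                 (transfer_op I \<phi> \<tau> V \<nu> (w 0) (w 1))
                 (exp (\<i> * of_real (\<nu> * \<tau> (x_pt I \<phi> (shift w))) + of_real (V (x_pt I \<phi> (shift w)))))
                 (normal_op \<nu> (I (shift w 0)) (\<Upsilon> \<nu> (shift w)) (x_pt I \<phi> (shift w)) J (lin_inv (shift w)))
                 (jac I \<phi> (w 0) (w 1) (x_pt I \<phi> w))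
                 (normal_op \<nu> (I (w 0)) (\<Upsilon> \<nu> w) (x_pt I \<phi> w) J (lin_inv w))"
    if w: "w \<in> words A" and \<nu>: "\<nu> > 0" for w \<nu>
  proof (intro exI conjI)
    show "open {y \<in> I (w 0). lin w y \<in> J}"
      by (rule open_chart[OF ctxt w])
    show "x_pt I \<phi> w \<in> {y \<in> I (w 0). lin w y \<in> J}"
      using x_pt_in[OF w] lin_base[OF w] \<delta> J by simp
    show "{y \<in> I (w 0). lin w y \<in> J} \<subseteq> I (w 0)" by blast
    have e: "\<i> * of_real \<nu> * \<Upsilon> \<nu> v x = \<i> * of_real (\<nu> * \<Upsilon>0 v x) - of_real (\<Upsilon>1 v x)" for v x
      using \<nu> by (simp add: \<Upsilon>_def symbol_def algebra_simps)
    show "conjugates_on {y \<in> I (w 0). lin w y \<in> J} J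
        (transfer_op I \<phi> \<tau> V \<nu> (w 0) (w 1))
        (exp (\<i> * of_real (\<nu> * \<tau> (x_pt I \<phi> (shift w))) + of_real (V (x_pt I \<phi> (shift w)))))
        (normal_op \<nu> (I (shift w 0)) (\<Upsilon> \<nu> (shift w)) (x_pt I \<phi> (shift w)) J (lin_inv (shift w)))
        (jac I \<phi> (w 0) (w 1) (x_pt I \<phi> w))
        (normal_op \<nu> (I (w 0)) (\<Upsilon> \<nu> w) (x_pt I \<phi> w) J (lin_inv w))"
    proof (rule conjugation[OF ctxt t w])
      fix z assume z: "z \<in> I (w 0)"
      let ?p = "\<phi> (w 0) (w 1) z" and ?x = "x_pt I \<phi> (shift w)"
      have "\<tau> ?x + \<Upsilon>0 (shift w) ?p - \<Upsilon>0 w z = \<tau> ?p"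
        using future_sum_shift[OF \<tau> w z] by (simp add: \<Upsilon>0_def)
      then have \<tau>_eq: "of_real (\<nu> * \<tau> ?p) = (of_real (\<nu> * \<tau> ?x) + of_real (\<nu> * \<Upsilon>0 (shift w) ?p) - of_real (\<nu> * \<Upsilon>0 w z) :: complex)"
        by (metis of_real_add of_real_diff distrib_left right_diff_distrib)
      have "V ?x - \<Upsilon>1 (shift w) ?p + \<Upsilon>1 w z = V ?p"
        using future_sum_shift[OF V w z] by (simp add: \<Upsilon>1_def)
      then have V_eq: "of_real (V ?p) = (of_real (V ?x) - of_real (\<Upsilon>1 (shift w) ?p) + of_real (\<Upsilon>1 w z) :: complex)"
        by (metis of_real_add of_real_diff)
      show "exp (\<i> * of_real (\<nu> * \<tau> ?x) + of_real (V ?x)) *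
          (exp (\<i> * of_real \<nu> * \<Upsilon> \<nu> (shift w) ?p) * exp (- (\<i> * of_real \<nu> * \<Upsilon> \<nu> w z)))
        = exp (\<i> * of_real (\<nu> * \<tau> ?p) + of_real (V ?p))"
        unfolding e exp_add[symmetric] \<tau>_eq V_eq by (simp add: algebra_simps del: of_real_mult)
    qed
  qed
  have H0: "lin_inv w 0 = 0" if "w \<in> words A" for w
    by (rule lin_inv_0[OF ctxt that])
  have J0: "0 \<in> J" and oJ: "open J" using \<delta> J by auto
  have H': "deriv_within J (lin_inv w) 0 = 1" if w: "w \<in> words A" for w
  proof (rule deriv_within_eq[OF at_within_open_neq_bot[OF oJ J0]])
    show "(lin_inv w has_vector_derivative 1) (at 0 within J)"
      using fam_derivD[OF lin_inv_fam_deriv(1)[OF ctxt] w J0]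
      by (simp add: H0[OF w] distortion_base)
  qed
  have nm: "normal_map (I (w 0)) (\<Upsilon>0 w) (x_pt I \<phi> w) J (lin_inv w) (0, 0) = (x_pt I \<phi> w, xi_pt A I \<phi> \<tau> w)"
    if w: "w \<in> words A" for w
    by (simp add: normal_map_def mult_map_def trans_map_def comp_map_def xi_pt_def H0[OF w]
        zeta[OF w x_pt_in[OF w]])
  have bounds: "\<exists>C::real. \<forall>w\<in>words A.
            Linf_norm J (nderiv J \<alpha> (lin_inv w)) < ereal C \<and>
            Linf_norm (lin_inv w ` J) (nderiv (lin_inv w ` J) \<alpha> (inv_into J (lin_inv w))) < ereal C \<and>
            Linf_norm (I (w 0)) (nderiv (I (w 0)) \<alpha> (\<Upsilon> \<nu> w)) < ereal C" for \<alpha> \<nu>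
  proof -
    obtain C1 where C1: "\<forall>w\<in>words A. Linf_norm J (nderiv J \<alpha> (lin_inv w)) < ereal C1"
      using tame_Linf_norm[OF tame_lin_inv[OF ctxt] perfect_J[OF ctxt] borel_open[OF oJ]] by blast
    obtain C2 where C2: "\<forall>w\<in>words A. Linf_norm (lin_inv w ` J) (nderiv (lin_inv w ` J) \<alpha> (inv_into J (lin_inv w))) < ereal C2"
      using tame_Linf_norm[OF tame_inv_lin_inv[OF ctxt] perfect_lin_inv_image[OF ctxt]
          borel_open[OF open_lin_inv_image[OF ctxt]]] by blast
    obtain C3 where C3: "\<forall>w\<in>words A. Linf_norm (I (w 0)) (nderiv (I (w 0)) \<alpha> (\<Upsilon> \<nu> w)) < ereal C3"
      using tame_Linf_norm[OF t perfect_I borel_I] by blast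
    have "ereal C1 \<le> ereal (max C1 (max C2 C3))" "ereal C2 \<le> ereal (max C1 (max C2 C3))"
      "ereal C3 \<le> ereal (max C1 (max C2 C3))" unfolding ereal_less_eq by auto
    with C1 C2 C3 show ?thesis by (meson less_le_trans)
  qed
  have sm: "smooth_on (I (w 0)) (\<Upsilon>0 w)" "smooth_on (I (w 0)) (\<Upsilon>1 w)" if w: "w \<in> words A" for w
    using tame_smooth[OF t0 perfect_I w] tame_smooth[OF t1 perfect_I w] by simp_all
  have im: "(\<lambda>y. x_pt I \<phi> w + lin_inv w y) ` J \<subseteq> I (w 0)" if w: "w \<in> words A" for w
    using lin_inv_in[OF ctxt w] by blast
  show ?thesis
    unfolding Let_def
    by (rule exI[of _ J], intro conjI oJ J0, rule exI[of _ lin_inv], rule exI[of _ \<Upsilon>0], rule exI[of _ \<Upsilon>1],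
        intro conjI ballI allI impI;
        rule sm lin_inv_diffeo[OF ctxt] im conj[unfolded \<Upsilon>_def] nm H0 H' base[unfolded \<Upsilon>_def] zeta
          bounds[unfolded \<Upsilon>_def]; assumption)
qed

end
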